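(* Let $F\in\mathcal{S}$. Then either $F=1$ (the constant function) or $d_F\ge 1$.
   Context: Write $\sigma=\Re s$, and for a function $\Phi$ put $\overline{\Phi}(s)=\overline{\Phi(\overline{s})}$. The Selberg class $\mathcal{S}$ is the set of Dirichlet series $F(s)=\sum_{n=1}^{\infty} a_n n^{-s}$ satisfying: (1) Analyticity: $(s-1)^mF(s)$ is (continues to) an entire function of finite order for some non-negative integer $m$. (2) Ramanujan hypothesis: $a_n\ll_\epsilon n^{\epsilon}$ for any fixed $\epsilon>0$. (3) Functional equation: there is a function $\gamma_F(s)=\epsilon Q^s\prod_{i=1}^{k}\Gamma(w_is+\mu_i)$ with $|\epsilon|=1$, $Q>0$, $w_i>0$, $\Re\mu_i\ge 0$ (the product of gamma functions may be empty, i.e. $k=0$ is allowed) such that $\Phi(s)=\gamma_F(s)F(s)$ satisfies $\Phi(s)=\overline{\Phi}(1-s)$. (4) Euler product: $a_1=1$ and $\log F(s)=\sum_{n=1}^{\infty} b_n n^{-s}$ (for $\sigma>1$), where $b_n=0$ unless $n$ is a positive power of a prime, and $b_n\ll n^{\theta}$ for some $\theta<1/2$. The degree of $F\in\mathcal{S}$ is $d_F=2\sum_{i=1}^{k}w_i$ (with $d_F=0$ if the product of gamma functions is empty); it does not depend on the choice of $\gamma_F$ satisfying (3). *)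

theory Defs
  imports
    "HOL-Complex_Analysis.Complex_Analysis"
    "HOL-Number_Theory.Prime_Powers"
    "HOL-Library.Landau_Symbols"
begin

definition finite_order :: "(complex \<Rightarrow> complex) \<Rightarrow> bool" where
  "finite_order G \<longleftrightarrow>
     (\<exists>\<rho>::real. (\<lambda>s. norm (G s)) \<in> O[at_infinity](\<lambda>s. exp (norm s powr \<rho>)))"

text \<open>The index is shifted, so \<open>a 0\<close> plays no role.\<close>

definition dirichlet_sums :: "(nat \<Rightarrow> complex) \<Rightarrow> complex \<Rightarrow> complex \<Rightarrow> bool" where
  "dirichlet_sums a s S \<longleftrightarrow> (\<lambda>n. a (Suc n) * of_nat (Suc n) powr (- s)) sums S"

definition conj_fun :: "(complex \<Rightarrow> complex) \<Rightarrow> complex \<Rightarrow> complex" where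
  "conj_fun \<Phi> s = cnj (\<Phi> (cnj s))"

definition gamma_factor ::
    "complex \<Rightarrow> real \<Rightarrow> nat \<Rightarrow> (nat \<Rightarrow> real) \<Rightarrow> (nat \<Rightarrow> complex) \<Rightarrow> complex \<Rightarrow> complex" where
  "gamma_factor \<epsilon> Q k w \<mu> s =
     \<epsilon> * of_real Q powr s * (\<Prod>i<k. Gamma (of_real (w i) * s + \<mu> i))"

text \<open>
  The functional equation is an identity of meromorphic functions, so it is required outside
  a set without limit points: the library assigns the value 0 to \<open>Gamma\<close> at its poles.
\<close>

definition functional_equation ::
    "(complex \<Rightarrow> complex) \<Rightarrow> complex \<Rightarrow> real \<Rightarrow> nat \<Rightarrow> (nat \<Rightarrow> real) \<Rightarrow> (nat \<Rightarrow> complex) \<Rightarrow> bool" where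
  "functional_equation F \<epsilon> Q k w \<mu> \<longleftrightarrow>
     norm \<epsilon> = 1 \<and> Q > 0 \<and> (\<forall>i<k. w i > 0 \<and> Re (\<mu> i) \<ge> 0) \<and>
     (let \<Phi> = (\<lambda>s. gamma_factor \<epsilon> Q k w \<mu> s * F s)
      in \<forall>\<^sub>\<approx>s\<in>UNIV. \<Phi> s = conj_fun \<Phi> (1 - s))"

text \<open>
  An element of the Selberg class is represented by the meromorphic continuation \<open>F\<close> of its
  Dirichlet series to the whole plane. The clause \<open>F nicely_meromorphic_on UNIV\<close> only
  normalises the value at \<open>s = 1\<close> (0 at a pole, the limit otherwise), so that equality of
  elements of the class is equality of functions.
  In the last clause, the sum of the series is a logarithm of \<open>F s\<close>. Since \<open>b 1 = 0\<close>, it is the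
  branch of the logarithm of \<open>F\<close> on \<open>Re s > 1\<close> that tends to 0 as \<open>Re s\<close> tends to infinity.
\<close>

definition selberg_class :: "(complex \<Rightarrow> complex) set" where
  "selberg_class = {F. F nicely_meromorphic_on UNIV \<and>
     (\<exists>a :: nat \<Rightarrow> complex.
        (\<forall>s. Re s > 1 \<longrightarrow> dirichlet_sums a s (F s)) \<and>
        (\<exists>(m::nat) G. G holomorphic_on UNIV \<and> finite_order G \<and>
           (\<forall>s. s \<noteq> 1 \<longrightarrow> G s = (s - 1) ^ m * F s)) \<and>
        (\<forall>\<epsilon>::real. \<epsilon> > 0 \<longrightarrow> (\<lambda>n. norm (a n)) \<in> O(\<lambda>n. real n powr \<epsilon>)) \<and>
        (\<exists>\<epsilon> Q k w \<mu>. functional_equation F \<epsilon> Q k w \<mu>) \<and>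
        a 1 = 1 \<and>
        (\<exists>b :: nat \<Rightarrow> complex.
           (\<forall>s. Re s > 1 \<longrightarrow> (\<exists>L. dirichlet_sums b s L \<and> exp L = F s)) \<and>
           (\<forall>n. \<not> primepow n \<longrightarrow> b n = 0) \<and>
           (\<exists>\<theta><1/2. (\<lambda>n. norm (b n)) \<in> O(\<lambda>n. real n powr \<theta>))))}"

text \<open>
  The degree is independent of the gamma factor. Rather than choosing one, \<open>d\<close> is called
  a degree of \<open>F\<close> if it is computed from some admissible gamma factor; a statement about all
  degrees of \<open>F\<close> then holds for every admissible gamma factor.
\<close>

definition has_selberg_degree :: "(complex \<Rightarrow> complex) \<Rightarrow> real \<Rightarrow> bool" where
  "has_selberg_degree F d \<longleftrightarrow>
     (\<exists>\<epsilon> Q k w \<mu>. functional_equation F \<epsilon> Q k w \<mu> \<and> d = 2 * (\<Sum>i<k. w i))"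

end

theory Submission
  imports Defs "HOL-Real_Asymp.Real_Asymp"
begin

text \<open>
  Suppose \<open>F\<close> has degree \<open>d < 1\<close>. The coefficient \<open>a n\<close> is the mean value of \<open>F s * n powr s\<close> over
  a vertical line to the right of \<open>1\<close>. By Phragmen-Lindelof, \<open>F\<close> grows more slowly than \<open>\<bar>t\<bar>\<close>
  on \<open>Re s \<ge> -A\<close> if \<open>A > 0\<close> is small, so the line may be moved to \<open>Re s = -A\<close>. There the
  functional equation expands \<open>F\<close> into oscillatory terms with amplitude
  \<open>t powr (d * (1/2 + A))\<close> and second phase derivative of size \<open>1/t\<close>. For \<open>d > 0\<close>, van der
  Corput's second derivative bound makes their integrals over \<open>[T0, T]\<close> of size
  \<open>T powr (d * (1/2 + A) + 1/2)\<close>, which is \<open>o(T)\<close>, so \<open>a 1 = 0\<close>: a contradiction.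

  For \<open>d = 0\<close> the same mean values show that \<open>q = Q\<^sup>2\<close> is an integer and that \<open>F\<close> is a Dirichlet
  polynomial supported on the divisors of \<open>q\<close>. Comparing coefficients in \<open>F' = F * (log F)'\<close>, the
  series of \<open>log F\<close> only involves powers of the primes dividing \<open>q\<close>; it therefore converges
  absolutely for \<open>Re s > \<theta>\<close> and is bounded on the critical line. There the functional equation
  says that \<open>\<epsilon> * Q powr s * F s\<close> is real, so the continuous function \<open>t * ln Q + Im (log F (1/2 + i t))\<close>
  is constant. Hence \<open>Q = 1\<close> and \<open>F = 1\<close>.
\<close>

section \<open>Oscillatory integrals and mean values\<close>

text \<open>Everything takes place in the upper half-plane: \<open>F\<close> may have a pole at 1,
  so the lines start at a positive height, and dividing by \<open>T\<close> removes the influence of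
  the lower end. The hypothesis d < 1 enters through one exponent. The Gamma quotient on Re s = -A
  has size t powr (d * (1/2 + A)), and van der Corput's bound costs a further square root of T, so
  this exponent has to stay below 1/2; a positive A achieves that exactly when d < 1. A has to be
  positive because the reflected series, on Re s = 1 + A, must converge absolutely. Sizes and phases
  of Gamma are recovered by integrating logarithmic derivatives, so only Polygamma has to be
  estimated. In degree zero nothing oscillates and the functional equation alone is not decisive:
  for a prime q, the Dirichlet polynomial 1 + q powr (1/2 - s) satisfies it with Q = sqrt q, and its
  logarithm is supported on powers of q with coefficients of modulus q powr (k/2) / k. Only the
  bound with \<theta> < 1/2 excludes it, which is why that part works with log F on the critical
  line.\<close>

lemma has_real_derivative_norm_complex:
  fixes f :: "real \<Rightarrow> complex"
  assumes "(f has_vector_derivative f t * w) (at t within S)" and "f t \<noteq> 0"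
  shows "((\<lambda>t. norm (f t)) has_real_derivative norm (f t) * Re w) (at t within S)"
proof -
  have "((\<lambda>t. norm (f t)) has_derivative (\<lambda>h. (h *\<^sub>R (f t * w)) \<bullet> sgn (f t))) (at t within S)"
    using has_derivative_compose[OF assms(1)[unfolded has_vector_derivative_def]
        has_derivative_norm[OF assms(2)]] by simp
  moreover have "(h *\<^sub>R (f t * w)) \<bullet> sgn (f t) = norm (f t) * Re w * h" for h
  proof -
    have "(f t * w) \<bullet> f t = (norm (f t))\<^sup>2 * Re w"
      unfolding cmod_power2 by (simp add: inner_complex_def power2_eq_square algebra_simps)
    then show ?thesis
      using assms(2) by (simp add: sgn_div_norm power2_eq_square field_simps)
  qed
  ultimately show ?thesis
    by (simp only: has_field_derivative_def)
qed

text \<open>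
  The weight \<open>q \<phi> = \<phi> / (\<phi>\<^sup>2 + lam)\<close> makes \<open>f * q \<phi>\<close> an approximate primitive of \<open>\<i> * f\<close>
  whose error is bounded by the derivative of an arctangent of \<open>\<phi>\<close> and of \<open>norm f\<close>; this avoids
  splitting the interval around the stationary point.
\<close>

lemma second_derivative_test:
  fixes f :: "real \<Rightarrow> complex" and \<rho> \<phi> \<phi>' :: "real \<Rightarrow> real"
  assumes "a \<le> b" and lam: "lam > 0"
    and df: "\<And>t. t \<in> {a..b} \<Longrightarrow> (f has_vector_derivative f t * Complex (\<rho> t) (\<phi> t)) (at t within {a..b})"
    and dphi: "\<And>t. t \<in> {a..b} \<Longrightarrow> (\<phi> has_real_derivative \<phi>' t) (at t within {a..b})"
    and rho: "\<And>t. t \<in> {a..b} \<Longrightarrow> \<rho> t \<ge> 0"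
    and phi': "\<And>t. t \<in> {a..b} \<Longrightarrow> \<phi>' t \<le> - lam"
    and nz: "\<And>t. t \<in> {a..b} \<Longrightarrow> f t \<noteq> 0"
  shows "norm (integral {a..b} f) \<le> 10 / sqrt lam * norm (f b)"
proof (cases "a = b")
  case True
  then show ?thesis using lam by simp
next
  case False
  with \<open>a \<le> b\<close> have ab: "a < b" by simp
  define s where "s = sqrt lam"
  have s: "s > 0" "s * s = lam" using lam by (auto simp: s_def)
  have cf: "continuous_on {a..b} f"
    by (rule continuous_on_vector_derivative[OF df])
  have dr: "((\<lambda>t. norm (f t)) has_real_derivative norm (f t) * \<rho> t) (at t within {a..b})" if "t \<in> {a..b}" for t
    using has_real_derivative_norm_complex[OF df[OF that] nz[OF that]] by simp
  have rmono: "norm (f t) \<le> norm (f u)" if "a \<le> t" "t \<le> u" "u \<le> b" for t u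
  proof (rule DERIV_nonneg_imp_increasing_open[OF that(2)])
    show "continuous_on {t..u} (\<lambda>t. norm (f t))"
      by (rule continuous_on_subset[OF continuous_on_norm[OF cf]]) (use that in auto)
    fix x assume x: "t < x" "x < u"
    have *: "at x within {a..b} = at x" by (rule at_within_interior) (use that x in auto)
    show "\<exists>y. ((\<lambda>t. norm (f t)) has_real_derivative y) (at x) \<and> 0 \<le> y"
      using dr[of x] rho[of x] that x by (auto simp: * intro!: exI[of _ "norm (f x) * \<rho> x"])
  qed
  have pos: "x\<^sup>2 + lam > 0" for x :: real using lam by (simp add: add_nonneg_pos)
  define q where "q = (\<lambda>x::real. x / (x\<^sup>2 + lam))"
  have q_le: "\<bar>q x\<bar> \<le> 1 / (2 * s)" for x
  proof -
    have "0 \<le> (\<bar>x\<bar> - s)\<^sup>2" by simp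
    then have "2 * s * \<bar>x\<bar> \<le> x\<^sup>2 + lam"
      using s by (simp add: power2_diff power2_eq_square algebra_simps)
    then show ?thesis using pos[of x] s by (simp add: q_def field_simps)
  qed
  define K where "K = (\<lambda>t. \<i> * integral {a..t} f - f t * of_real (q (\<phi> t)))"
  define K' where "K' = (\<lambda>t. f t * (Complex 0 (lam / ((\<phi> t)\<^sup>2 + lam)) - of_real (\<rho> t * q (\<phi> t))
     - of_real (\<phi>' t * (lam - (\<phi> t)\<^sup>2) / ((\<phi> t)\<^sup>2 + lam)\<^sup>2)))"
  define G where "G = (\<lambda>t. norm (f b) * (- (2 / s) * arctan (\<phi> t / s)) + norm (f t) / (2 * s))"
  define G' where "G' = (\<lambda>t. norm (f b) * (- 2 * \<phi>' t / ((\<phi> t)\<^sup>2 + lam)) + norm (f t) * \<rho> t / (2 * s))"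
  have dq: "((\<lambda>t. q (\<phi> t)) has_real_derivative \<phi>' t * (lam - (\<phi> t)\<^sup>2) / ((\<phi> t)\<^sup>2 + lam)\<^sup>2) (at t within {a..b})"
    if "t \<in> {a..b}" for t
    unfolding q_def using pos[of "\<phi> t"]
    by (auto intro!: derivative_eq_intros dphi[OF that] simp: field_simps power2_eq_square power4_eq_xxxx)
  have dK: "(K has_vector_derivative K' t) (at t within {a..b})" if t: "t \<in> {a..b}" for t
  proof -
    have 1: "((\<lambda>t. integral {a..t} f) has_vector_derivative f t) (at t within {a..b})"
      by (rule integral_has_vector_derivative[OF cf t])
    have 2: "((\<lambda>t. complex_of_real (q (\<phi> t))) has_vector_derivative
        of_real (\<phi>' t * (lam - (\<phi> t)\<^sup>2) / ((\<phi> t)\<^sup>2 + lam)\<^sup>2)) (at t within {a..b})"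
      by (rule has_vector_derivative_of_real[OF dq[OF t]])
    have "(K has_vector_derivative \<i> * f t - (f t * of_real (\<phi>' t * (lam - (\<phi> t)\<^sup>2) / ((\<phi> t)\<^sup>2 + lam)\<^sup>2)
         + f t * Complex (\<rho> t) (\<phi> t) * of_real (q (\<phi> t)))) (at t within {a..b})"
      unfolding K_def
      by (intro has_vector_derivative_diff has_vector_derivative_mult_right has_vector_derivative_mult 1 2 df t)
    moreover have "1 - \<phi> t * q (\<phi> t) = lam / ((\<phi> t)\<^sup>2 + lam)"
      using pos[of "\<phi> t"] by (simp add: q_def diff_divide_eq_iff power2_eq_square)
    then have "\<i> - Complex (\<rho> t) (\<phi> t) * of_real (q (\<phi> t)) =
        Complex 0 (lam / ((\<phi> t)\<^sup>2 + lam)) - of_real (\<rho> t * q (\<phi> t))"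
      by (simp add: complex_eq_iff)
    then have "f t * (\<i> - Complex (\<rho> t) (\<phi> t) * of_real (q (\<phi> t))) = 
        f t * (Complex 0 (lam / ((\<phi> t)\<^sup>2 + lam)) - of_real (\<rho> t * q (\<phi> t)))"
      by simp
    then have "\<i> * f t - (f t * of_real (\<phi>' t * (lam - (\<phi> t)\<^sup>2) / ((\<phi> t)\<^sup>2 + lam)\<^sup>2)
         + f t * Complex (\<rho> t) (\<phi> t) * of_real (q (\<phi> t))) = K' t"
      unfolding K'_def right_diff_distrib by (simp only: mult_ac diff_diff_eq add_ac) (simp add: algebra_simps)
    ultimately show ?thesis by simp
  qed
  have dG: "(G has_vector_derivative G' t) (at t within {a..b})" if t: "t \<in> {a..b}" for t
  proof -
    have "1 / (s * (1 + (\<phi> t / s)\<^sup>2)) = s / ((\<phi> t)\<^sup>2 + lam)"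
    proof -
      have "s * (1 + (\<phi> t / s)\<^sup>2) = ((\<phi> t)\<^sup>2 + lam) / s"
        using s(1) unfolding s(2)[symmetric] by (simp add: field_simps power2_eq_square)
      then show ?thesis by simp
    qed
    note this[symmetric]
    then have e: "inverse (1 + (\<phi> t / s)\<^sup>2) * (\<phi>' t / s) = \<phi>' t * (s / ((\<phi> t)\<^sup>2 + lam))"
      by (simp only: divide_inverse inverse_mult_distrib mult_1 mult_ac)
    have 1: "((\<lambda>t. arctan (\<phi> t / s)) has_real_derivative \<phi>' t * (s / ((\<phi> t)\<^sup>2 + lam))) (at t within {a..b})"
      unfolding e[symmetric] using s(1)
      by (auto intro!: derivative_eq_intros dphi[OF t])
    have "(G has_real_derivative norm (f b) * (- (2 / s) * (\<phi>' t * (s / ((\<phi> t)\<^sup>2 + lam)))) + norm (f t) * \<rho> t / (2 * s)) (at t within {a..b})"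
      unfolding G_def by (intro DERIV_add DERIV_cmult DERIV_cdivide 1 dr t)
    moreover have "norm (f b) * (- (2 / s) * (\<phi>' t * (s / ((\<phi> t)\<^sup>2 + lam)))) + norm (f t) * \<rho> t / (2 * s) = G' t"
    proof -
      have "- (2 / s) * (\<phi>' t * (s / ((\<phi> t)\<^sup>2 + lam))) = - 2 * \<phi>' t / ((\<phi> t)\<^sup>2 + lam)"
        using s(1) by simp
      then show ?thesis unfolding G'_def by (simp only:)
    qed
    ultimately show ?thesis
      by (simp add: has_real_derivative_iff_has_vector_derivative)
  qed
  have le: "norm (K' t) \<le> G' t" if t: "t \<in> {a..b}" for t
  proof -
    let ?d = "(\<phi> t)\<^sup>2 + lam"
    have a1: "norm (Complex 0 (lam / ?d)) \<le> - \<phi>' t / ?d"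
      using pos[of "\<phi> t"] phi'[OF t] lam divide_right_mono[of lam "- \<phi>' t" ?d] by (simp add: complex_norm)
    have a2: "norm (complex_of_real (\<rho> t * q (\<phi> t))) \<le> \<rho> t * (1 / (2 * s))"
      using rho[OF t] q_le[of "\<phi> t"] unfolding norm_of_real abs_mult by (intro mult_mono) auto
    have "\<bar>lam - (\<phi> t)\<^sup>2\<bar> \<le> ?d" using lam by (simp add: abs_le_iff)
    then have "\<bar>\<phi>' t\<bar> * \<bar>lam - (\<phi> t)\<^sup>2\<bar> / ?d\<^sup>2 \<le> \<bar>\<phi>' t\<bar> * ?d / ?d\<^sup>2"
      by (intro divide_right_mono mult_left_mono) auto
    also have "\<dots> = - \<phi>' t / ?d"
      using phi'[OF t] lam pos[of "\<phi> t"] by (simp add: power2_eq_square)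
    finally have a3: "norm (complex_of_real (\<phi>' t * (lam - (\<phi> t)\<^sup>2) / ?d\<^sup>2)) \<le> - \<phi>' t / ?d"
      unfolding norm_of_real by (simp add: abs_mult)
    have "norm (K' t) \<le> norm (f t) * (- \<phi>' t / ?d + \<rho> t * (1 / (2 * s)) + (- \<phi>' t / ?d))"
      unfolding K'_def norm_mult
      by (intro mult_left_mono norm_ge_zero norm_triangle_le_diff add_mono a1 a2 a3)
    also have "\<dots> = norm (f t) * (- 2 * \<phi>' t / ?d) + norm (f t) * \<rho> t / (2 * s)"
      by (simp add: field_simps)
    also have "\<dots> \<le> G' t"
      unfolding G'_def using rmono[of t b] t phi'[OF t] lam pos[of "\<phi> t"]
      by (intro add_right_mono mult_right_mono divide_nonneg_pos) auto
    finally show ?thesis .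
  qed
  have "norm (K b - K a) \<le> G b - G a"
  proof (rule differentiable_bound_general[OF ab])
    show "continuous_on {a..b} K" by (rule continuous_on_vector_derivative[OF dK])
    show "continuous_on {a..b} G" by (rule continuous_on_vector_derivative[OF dG])
    fix x assume x: "a < x" "x < b"
    have *: "at x within {a..b} = at x" by (rule at_within_interior) (use x in auto)
    show "(K has_vector_derivative K' x) (at x)" "(G has_vector_derivative G' x) (at x)"
      using dK[of x] dG[of x] x by (simp_all add: *)
    show "norm (K' x) \<le> G' x" using le x by simp
  qed
  \<comment> \<open>The arctangent varies by at most pi, whatever the length of the interval and
    wherever the stationary point lies.\<close>
  moreover have "G b - G a \<le> norm (f b) * (2 * pi / s) + norm (f b) / (2 * s)"
  proof -
    have "(2 / s) * (arctan (\<phi> a / s) - arctan (\<phi> b / s)) \<le> (2 / s) * pi"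
      using s arctan_bounded[of "\<phi> a / s"] arctan_bounded[of "\<phi> b / s"] by (intro mult_left_mono) auto
    then have "norm (f b) * ((2 / s) * (arctan (\<phi> a / s) - arctan (\<phi> b / s))) \<le> norm (f b) * (2 * pi / s)"
      by (intro mult_left_mono) auto
    moreover have "norm (f a) / (2 * s) \<ge> 0" using s by simp
    ultimately show ?thesis unfolding G_def by (simp add: algebra_simps)
  qed
  moreover have "norm (f b * of_real (q (\<phi> b))) \<le> norm (f b) * (1 / (2 * s))"
    unfolding norm_mult using q_le[of "\<phi> b"] by (intro mult_left_mono) auto
  moreover have "norm (f a * of_real (q (\<phi> a))) \<le> norm (f b) * (1 / (2 * s))"
    unfolding norm_mult using q_le[of "\<phi> a"] rmono[of a b] ab by (intro mult_mono) auto
  moreover have "\<i> * integral {a..b} f = (K b - K a) + f b * of_real (q (\<phi> b)) - f a * of_real (q (\<phi> a))"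
    by (simp add: K_def)
  then have "norm (\<i> * integral {a..b} f) \<le> norm (K b - K a) + norm (f b * of_real (q (\<phi> b))) + norm (f a * of_real (q (\<phi> a)))"
    using norm_triangle_ineq4[of "(K b - K a) + f b * of_real (q (\<phi> b))" "f a * of_real (q (\<phi> a))"]
      norm_triangle_ineq[of "K b - K a" "f b * of_real (q (\<phi> b))"] by simp
  then have "norm (integral {a..b} f) \<le> norm (K b - K a) + norm (f b * of_real (q (\<phi> b))) + norm (f a * of_real (q (\<phi> a)))"
    by (simp only: norm_mult norm_ii mult_1)
  ultimately have "norm (integral {a..b} f) \<le> norm (f b) * (2 * pi / s) + norm (f b) / (2 * s) + norm (f b) * (1 / (2 * s)) + norm (f b) * (1 / (2 * s))"
    by linarith
  also have "\<dots> = (norm (f b) / s) * (2 * pi + 3 / 2)" using s by (simp add: field_simps)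
  \<comment> \<open>2 * pi comes from the arctangent, and 1/2 each from the modulus in
    \<open>G\<close> and from the two boundary terms of \<open>K\<close>; pi < 4 is enough for the
    total to stay below 10.\<close>
  also have "\<dots> \<le> (norm (f b) / s) * 10"
    by (rule mult_left_mono) (use pi_less_4 s in \<open>linarith, simp\<close>)
  finally show ?thesis by (simp add: s_def field_simps)
qed

text \<open>The series converges uniformly in t and \<open>h\<close> is bounded on the compact
  interval, so sum and integral commute. The factor \<open>h\<close> is 1 for plain mean values and
  the Gamma quotient where an oscillation bound is applied to each term.\<close>

lemma integral_exponential_series:
  fixes c :: "nat \<Rightarrow> complex" and l :: "nat \<Rightarrow> real" and h :: "real \<Rightarrow> complex"
  assumes c: "summable (\<lambda>k. norm (c k))" and h: "continuous_on {a..b} h"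
  shows "(\<lambda>k. c k * integral {a..b} (\<lambda>t. h t * cis (l k * t))) sums
           integral {a..b} (\<lambda>t. h t * (\<Sum>k. c k * cis (l k * t)))"
proof -
  have "bounded (h ` {a..b})" using compact_continuous_image[OF h] compact_imp_bounded by blast
  then obtain B where B: "\<And>t. t \<in> {a..b} \<Longrightarrow> norm (h t) \<le> B" unfolding bounded_iff by blast
  have u: "uniform_limit {a..b} (\<lambda>n t. \<Sum>k<n. h t * (c k * cis (l k * t))) (\<lambda>t. \<Sum>k. h t * (c k * cis (l k * t))) sequentially"
  proof (rule Weierstrass_m_test)
    show "norm (h t * (c n * cis (l n * t))) \<le> B * norm (c n)" if "t \<in> {a..b}" for n t
      using B[OF that] by (simp add: norm_mult mult_right_mono)
    show "summable (\<lambda>n. B * norm (c n))" using c by (rule summable_mult)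
  qed
  have cont: "continuous_on {a..b} (\<lambda>t. h t * (c k * cis (l k * t)))" for k
    by (intro continuous_intros h)
  obtain I J where I: "\<And>n. ((\<lambda>t. \<Sum>k<n. h t * (c k * cis (l k * t))) has_integral I n) {a..b}"
    and J: "((\<lambda>t. \<Sum>k. h t * (c k * cis (l k * t))) has_integral J) {a..b}" and IJ: "I \<longlonglongrightarrow> J"
    using uniform_limit_integral[OF u continuous_on_sum[OF cont] trivial_limit_sequentially] by blast
  have int: "(\<lambda>t. h t * (c k * cis (l k * t))) integrable_on {a..b}" for k
    by (rule integrable_continuous_real[OF cont])
  have "integral {a..b} (\<lambda>t. h t * (c k * cis (l k * t))) = c k * integral {a..b} (\<lambda>t. h t * cis (l k * t))" for k
    by (simp add: mult.left_commute)
  then have "I = (\<lambda>n. \<Sum>k<n. c k * integral {a..b} (\<lambda>t. h t * cis (l k * t)))"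
    using integral_unique[OF I] integral_sum[OF finite_lessThan int] by (auto simp: fun_eq_iff)
  then have "(\<lambda>k. c k * integral {a..b} (\<lambda>t. h t * cis (l k * t))) sums J"
    using IJ by (simp add: sums_def)
  moreover have "(\<Sum>k. h t * (c k * cis (l k * t))) = h t * (\<Sum>k. c k * cis (l k * t))" for t
    by (rule suminf_mult) (rule summable_norm_cancel, simp add: norm_mult c)
  ultimately show ?thesis using integral_unique[OF J] by simp
qed

lemma integral_cis_bound:
  assumes "l \<noteq> 0" "a \<le> T"
  shows "norm (integral {a..T} (\<lambda>t. cis (l * t))) \<le> 2 / \<bar>l\<bar>"
proof -
  have "((\<lambda>t. cis (l * t)) has_integral (cis (l * T) / (\<i> * l) - cis (l * a) / (\<i> * l))) {a..T}"
  proof (rule fundamental_theorem_of_calculus[OF assms(2)])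
    fix x assume "x \<in> {a..T}"
    have "((\<lambda>t. exp (\<i> * l * of_real t) / (\<i> * l)) has_vector_derivative exp (\<i> * l * x)) (at x within {a..T})"
      using assms(1) by (auto intro!: derivative_eq_intros has_vector_derivative_real_field)
    then show "((\<lambda>t. cis (l * t) / (\<i> * l)) has_vector_derivative cis (l * x)) (at x within {a..T})"
      by (simp add: cis_conv_exp algebra_simps)
  qed
  then have "integral {a..T} (\<lambda>t. cis (l * t)) = cis (l * T) / (\<i> * l) - cis (l * a) / (\<i> * l)"
    by (rule integral_unique)
  then have "norm (integral {a..T} (\<lambda>t. cis (l * t))) \<le> norm (cis (l * T) / (\<i> * l)) + norm (cis (l * a) / (\<i> * l))"
    by (metis norm_triangle_ineq4)
  then show ?thesis by (simp add: norm_divide norm_mult)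
qed

text \<open>A term of nonzero frequency has a bounded integral, so its mean tends to 0; a constant
  term is its own mean. The frequencies may accumulate at 0, where the integral bounds blow up, so
  the limit is taken under the sum by domination (Tannery) with the coefficients alone.\<close>

lemma mean_value_exponential_series:
  fixes c :: "nat \<Rightarrow> complex" and l :: "nat \<Rightarrow> real"
  assumes c: "summable (\<lambda>k. norm (c k))"
  shows "((\<lambda>T. integral {a..T} (\<lambda>t. \<Sum>k. c k * cis (l k * t)) / of_real T) \<longlongrightarrow>
           (\<Sum>k. if l k = 0 then c k else 0)) at_top"
proof -
  define I where "I = (\<lambda>k T. integral {a..T} (\<lambda>t. cis (l k * t)) / of_real T)"
  have sums: "(\<lambda>k. c k * I k T) sums (integral {a..T} (\<lambda>t. \<Sum>k. c k * cis (l k * t)) / of_real T)" for T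
    using sums_divide[OF integral_exponential_series[OF c, of a T "\<lambda>_. 1" l], of "of_real T"]
    by (simp add: I_def)
  have tt: "((\<lambda>T. \<Sum>k. c k * I k T) \<longlongrightarrow> (\<Sum>k. if l k = 0 then c k else 0)) at_top"
  proof (rule conjunct2[OF conjunct2[OF tannerys_theorem[where M = "\<lambda>k. (1 + \<bar>a\<bar>) * norm (c k)"]]])
    show "((\<lambda>T. c k * I k T) \<longlongrightarrow> (if l k = 0 then c k else 0)) at_top" for k
    proof (cases "l k = 0")
      case True
      have "((\<lambda>T. (T - a) / T) \<longlongrightarrow> 1) at_top" by real_asymp
      then have "((\<lambda>T. complex_of_real ((T - a) / T)) \<longlongrightarrow> of_real 1) at_top" by (rule tendsto_of_real)
      moreover have "\<forall>\<^sub>F T in at_top. complex_of_real ((T - a) / T) = I k T"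
        using eventually_ge_at_top[of a] by eventually_elim (simp add: I_def True scaleR_conv_of_real)
      ultimately have "(I k \<longlongrightarrow> 1) at_top" using Lim_transform_eventually by fastforce
      then show ?thesis using tendsto_mult_left[of "I k" 1 at_top "c k"] True by simp
    next
      case False
      have "(I k \<longlongrightarrow> 0) at_top"
      proof (rule Lim_null_comparison)
        show "((\<lambda>T. 2 / \<bar>l k\<bar> / T) \<longlongrightarrow> 0) at_top" by real_asymp
        show "\<forall>\<^sub>F T in at_top. norm (I k T) \<le> 2 / \<bar>l k\<bar> / T"
          using eventually_ge_at_top[of a] eventually_gt_at_top[of 0]
        proof eventually_elim
          case (elim T)
          then show ?case using integral_cis_bound[OF False, of a T]
            unfolding I_def norm_divide by (simp add: divide_right_mono del: divide_divide_eq_left)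
        qed
      qed
      then show ?thesis using tendsto_mult_right_zero[of "I k" at_top "c k"] False by simp
    qed
    show "\<forall>\<^sub>F (k, T) in at_top \<times>\<^sub>F at_top. norm (c k * I k T) \<le> (1 + \<bar>a\<bar>) * norm (c k)"
    proof -
      have "\<forall>\<^sub>F T in at_top. \<forall>k. norm (c k * I k T) \<le> (1 + \<bar>a\<bar>) * norm (c k)"
        using eventually_ge_at_top[of a] eventually_ge_at_top[of 1]
      proof eventually_elim
        case (elim T)
        show ?case
        proof
          fix k
          have "norm (integral {a..T} (\<lambda>t. cis (l k * t))) \<le> 1 * (T - a)"
            by (rule integral_bound[OF elim(1)]) (auto intro!: continuous_intros)
          \<comment> \<open>The lower limit \<open>a\<close> may be negative, so the interval can be
            longer than T; T \<ge> 1 absorbs the excess.\<close>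
          also have "\<dots> \<le> (1 + \<bar>a\<bar>) * T"
            using elim mult_left_mono[of 1 T "\<bar>a\<bar>"] by (simp add: algebra_simps)
          finally have "norm (I k T) \<le> 1 + \<bar>a\<bar>"
            using elim by (simp add: I_def norm_divide field_simps)
          then show "norm (c k * I k T) \<le> (1 + \<bar>a\<bar>) * norm (c k)"
            by (simp add: norm_mult mult.commute mult_left_mono)
        qed
      qed
      then show ?thesis
        using eventually_prod2[of sequentially "\<lambda>T. \<forall>k. norm (c k * I k T) \<le> (1 + \<bar>a\<bar>) * norm (c k)" at_top]
        by (auto elim!: eventually_mono)
    qed
    show "summable (\<lambda>k. (1 + \<bar>a\<bar>) * norm (c k))" using c by (rule summable_mult)
  qed auto
  then show ?thesis using sums_unique[OF sums] by simp
qed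

section \<open>The Phragmen-Lindelof principle in a half-strip\<close>

text \<open>In a vertical half-strip the argument of -\<i> * s tends to 0 as Im s grows, so (-\<i> *
  s) ^ Suc p has real part comparable to Im s ^ Suc p. Its exponential therefore damps growth of
  order \<open>p\<close>, for any \<open>p\<close>, and the maximum principle applies on a tall
  rectangle.\<close>

lemma phragmen_lindelof_half_strip:
  fixes f :: "complex \<Rightarrow> complex" and p :: nat
  assumes "\<alpha> < \<beta>" "T0 > 0"
    and hol: "f holomorphic_on {s. Im s > 0}"
    and growth: "\<And>s. \<alpha> \<le> Re s \<Longrightarrow> Re s \<le> \<beta> \<Longrightarrow> Im s \<ge> T0 \<Longrightarrow> norm (f s) \<le> C * exp (norm s ^ p)"
    and left: "\<And>t. t \<ge> T0 \<Longrightarrow> norm (f (Complex \<alpha> t)) \<le> M"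
    and right: "\<And>t. t \<ge> T0 \<Longrightarrow> norm (f (Complex \<beta> t)) \<le> M"
  shows "\<exists>M'. \<forall>s. \<alpha> \<le> Re s \<longrightarrow> Re s \<le> \<beta> \<longrightarrow> Im s \<ge> T0 \<longrightarrow> norm (f s) \<le> M'"
proof -
  define m where "m = \<bar>\<alpha>\<bar> + \<bar>\<beta>\<bar> + 1"
  have "isCont (\<lambda>z::complex. Re (z ^ Suc p)) 1" by (intro isCont_Re isCont_power) simp
  then obtain \<eta> where eta: "\<eta> > 0" "\<And>z::complex. dist z 1 < \<eta> \<Longrightarrow> dist (Re (z ^ Suc p)) (Re (1 ^ Suc p)) < 1/2"
    using continuous_at_eps_delta[of 1 "\<lambda>z::complex. Re (z ^ Suc p)"]
    by (meson half_gt_zero zero_less_one)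
  \<comment> \<open>Above this height -\<i> * s / Im s differs from 1 by at most m / Im s < \<eta>,
    so its power has real part at least 1/2.\<close>
  define T1 where "T1 = max (max T0 m) (m / \<eta> + 1)"
  have T1: "T1 \<ge> T0" "T1 \<ge> m" "T1 > m / \<eta>" by (auto simp: T1_def)
  have m0: "m > 0" by (simp add: m_def)
  have Re_ge: "Re ((- \<i> * s) ^ Suc p) \<ge> Im s ^ Suc p / 2" if s: "\<alpha> \<le> Re s" "Re s \<le> \<beta>" "Im s \<ge> T1" for s
  proof -
    note [simp del] = power_Suc
    let ?t = "Im s"
    have t: "?t > 0" using s T1 m0 by linarith
    define z where "z = - \<i> * s / of_real ?t"
    have "z - 1 = - \<i> * of_real (Re s) / of_real ?t"
      using t by (simp add: z_def complex_eq_iff Re_divide_of_real Im_divide_of_real)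
    then have "norm (z - 1) = \<bar>Re s\<bar> / ?t" using t by (simp add: norm_divide norm_mult)
    also have "\<dots> \<le> m / ?t" using s t by (intro divide_right_mono) (auto simp: m_def)
    also have "\<dots> < \<eta>"
    proof -
      have "m / \<eta> < ?t" using s T1 by linarith
      then show ?thesis using eta(1) t by (simp add: field_simps)
    qed
    finally have "dist (Re (z ^ Suc p)) 1 < 1/2" using eta(2)[of z] by (simp add: dist_norm)
    then have "Re (z ^ Suc p) \<ge> 1/2"
      unfolding dist_real_def abs_less_iff by linarith
    moreover have "- \<i> * s = of_real ?t * z" using t by (simp add: z_def)
    then have "(- \<i> * s) ^ Suc p = of_real (?t ^ Suc p) * z ^ Suc p"
      by (simp only: power_mult_distrib of_real_power)
    then have "Re ((- \<i> * s) ^ Suc p) = ?t ^ Suc p * Re (z ^ Suc p)" by (simp del: of_real_power)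
    ultimately show ?thesis using mult_left_mono[of "1/2" "Re (z ^ Suc p)" "?t ^ Suc p"] t by simp
  qed
  define S where "S = cbox (Complex \<alpha> T0) (Complex \<beta> T1)"
  have inS: "s \<in> S \<longleftrightarrow> \<alpha> \<le> Re s \<and> Re s \<le> \<beta> \<and> T0 \<le> Im s \<and> Im s \<le> T1" for s
    by (auto simp: S_def in_cbox_complex_iff)
  have contf: "continuous_on {s. Im s > 0} f" by (rule holomorphic_on_imp_continuous_on[OF hol])
  have "compact (f ` S)"
    by (rule compact_continuous_image[OF continuous_on_subset[OF contf]])
       (use \<open>T0 > 0\<close> in \<open>auto simp: inS\<close>, simp add: S_def)
  then have "bounded (f ` S)" by (rule compact_imp_bounded)
  then obtain B where B: "\<And>s. s \<in> S \<Longrightarrow> norm (f s) \<le> B"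
    unfolding bounded_iff by auto
  \<comment> \<open>\<open>B\<close> serves the compact piece between the heights \<open>T0\<close>
    and \<open>T1\<close>, \<open>M\<close> the vertical sides, and 1 the top edge, where the damped
    function is small.\<close>
  define M' where "M' = max (max B M) 1"
  have "norm (f s) \<le> M'" if s: "\<alpha> \<le> Re s" "Re s \<le> \<beta>" "Im s \<ge> T0" for s
  proof (cases "Im s \<le> T1")
    case True
    then show ?thesis using B[of s] s by (auto simp: inS M'_def)
  next
    case False
    \<comment> \<open>The bound \<open>M'\<close> does not depend on \<open>e\<close>, so letting
      \<open>e\<close> tend to 0 at the end removes the damping factor.\<close>
    have "norm (f s) * exp (- e * Re ((- \<i> * s) ^ Suc p)) \<le> M'" if e: "e > 0" for e
    proof -
      note [simp del] = power_Suc
      define g where "g = (\<lambda>s. f s * exp (- of_real e * (- \<i> * s) ^ Suc p))"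
      have ng: "norm (g s) = norm (f s) * exp (- e * Re ((- \<i> * s) ^ Suc p))" for s
        by (simp add: g_def norm_mult norm_exp_eq_Re)
      have g_le: "norm (g s) \<le> norm (f s) * exp (- e * (Im s ^ Suc p / 2))"
        if "\<alpha> \<le> Re s" "Re s \<le> \<beta>" "Im s \<ge> T1" for s
        unfolding ng using Re_ge[OF that] e by (intro mult_left_mono) auto
      have g_le': "norm (g s) \<le> norm (f s)"
        if "\<alpha> \<le> Re s" "Re s \<le> \<beta>" "Im s \<ge> T1" for s
      proof -
        have "Im s \<ge> 0" using that T1 m0 by linarith
        then have "exp (- e * (Im s ^ Suc p / 2)) \<le> 1" using e by simp
        then show ?thesis using g_le[OF that] mult_left_mono[of "exp (- e * (Im s ^ Suc p / 2))" 1 "norm (f s)"] by simp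
      qed
      \<comment> \<open>This is the bound on the top edge Im s = Y, where norm s \<le> 2 * Y as soon
        as Y \<ge> m. The degree \<open>Suc p\<close> of the damping beats \<open>p\<close>.\<close>
      have "((\<lambda>Y. C * exp ((2 * Y) ^ p - e * (Y ^ Suc p / 2))) \<longlongrightarrow> C * 0) at_top"
      proof (intro tendsto_intros filterlim_compose[OF exp_at_bot])
        have "filterlim (\<lambda>Y. Y ^ p * (e / 2 * Y - 2 ^ p)) at_top at_top"
        proof (cases "p = 0")
          case False
          have "filterlim (\<lambda>Y::real. e / 2 * Y - 2 ^ p) at_top at_top" using e by real_asymp
          then show ?thesis
            using False by (intro filterlim_at_top_mult_at_top filterlim_pow_at_top filterlim_ident) auto
        next
          case True
          have "filterlim (\<lambda>Y::real. e / 2 * Y - 1) at_top at_top" using e by real_asymp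
          then show ?thesis using True by simp
        qed
        then have "filterlim (\<lambda>Y. - (Y ^ p * (e / 2 * Y - 2 ^ p))) at_bot at_top"
          by (simp add: filterlim_uminus_at_top)
        then show "filterlim (\<lambda>Y. (2 * Y) ^ p - e * (Y ^ Suc p / 2)) at_bot at_top"
          by (simp add: right_diff_distrib power_mult_distrib mult_ac power_Suc)
      qed
      then have "\<forall>\<^sub>F Y in at_top. C * exp ((2 * Y) ^ p - e * (Y ^ Suc p / 2)) < 1"
        by (intro order_tendstoD(2)) auto
      then have "\<forall>\<^sub>F Y in at_top. C * exp ((2 * Y) ^ p - e * (Y ^ Suc p / 2)) < 1 \<and> Y \<ge> Im s \<and> Y \<ge> T1"
        by (intro eventually_conj eventually_ge_at_top)
      then obtain Y where Y: "C * exp ((2 * Y) ^ p - e * (Y ^ Suc p / 2)) < 1" "Y \<ge> Im s" "Y \<ge> T1"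
        using eventually_happens'[OF trivial_limit_at_top_linorder] by fastforce
      define R where "R = cbox (Complex \<alpha> T1) (Complex \<beta> Y)"
      have inR: "s \<in> R \<longleftrightarrow> \<alpha> \<le> Re s \<and> Re s \<le> \<beta> \<and> T1 \<le> Im s \<and> Im s \<le> Y" for s
        by (auto simp: R_def in_cbox_complex_iff)
      have Rsub: "R \<subseteq> {s. Im s > 0}" using T1 m0 by (auto simp: inR)
      have holg: "g holomorphic_on {s. Im s > 0}" unfolding g_def by (intro holomorphic_intros hol)
      have "norm (g s) \<le> M'"
      proof (rule maximum_modulus_frontier[where S = R and f = g and \<xi> = s])
        show "g holomorphic_on interior R"
          by (rule holomorphic_on_subset[OF holg order_trans[OF interior_subset Rsub]])
        show "continuous_on (closure R) g"
          using holomorphic_on_imp_continuous_on[OF holomorphic_on_subset[OF holg Rsub]]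
          by (simp add: R_def)
        show "bounded R" by (simp add: R_def)
        show "s \<in> R" using s False Y by (auto simp: inR)
        fix z assume "z \<in> frontier R"
        then have zR: "z \<in> R" and nb: "z \<notin> box (Complex \<alpha> T1) (Complex \<beta> Y)"
          by (auto simp: R_def frontier_cbox)
        have z': "\<alpha> \<le> Re z" "Re z \<le> \<beta>" "Im z \<ge> T1" using zR by (auto simp: inR)
        consider "Re z = \<alpha>" | "Re z = \<beta>" | "Im z = T1" | "Im z = Y"
          using zR nb by (force simp: inR in_box_complex_iff)
        then show "norm (g z) \<le> M'"
        proof cases
          case 1
          then have "z = Complex \<alpha> (Im z)" by (simp add: complex_eq_iff)
          then have "norm (f z) \<le> M" using left[of "Im z"] z' T1 by simp
          then show ?thesis using g_le'[OF z'] by (simp add: M'_def)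
        next
          case 2
          then have "z = Complex \<beta> (Im z)" by (simp add: complex_eq_iff)
          then have "norm (f z) \<le> M" using right[of "Im z"] z' T1 by simp
          then show ?thesis using g_le'[OF z'] by (simp add: M'_def)
        next
          case 3
          then show ?thesis using B[of z] g_le'[OF z'] z' T1 by (auto simp: inS M'_def)
        next
          case 4
          have "norm z \<le> \<bar>Re z\<bar> + \<bar>Im z\<bar>" by (rule cmod_le)
          also have "\<dots> \<le> 2 * Y" using z' 4 T1 m0 by (auto simp: m_def)
          finally have nz: "norm z ^ p \<le> (2 * Y) ^ p" by (intro power_mono) auto
          have fz: "norm (f z) \<le> C * exp (norm z ^ p)" using growth z' T1 by auto
          then have C: "C \<ge> 0" by (meson exp_gt_zero norm_ge_zero order_trans zero_le_mult_iff not_less)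
          have "norm (g z) \<le> norm (f z) * exp (- e * (Y ^ Suc p / 2))" using g_le[OF z'] 4 by simp
          also have "\<dots> \<le> (C * exp ((2 * Y) ^ p)) * exp (- e * (Y ^ Suc p / 2))"
            using fz nz C by (intro mult_right_mono order_trans[OF fz] mult_left_mono) auto
          also have "\<dots> = C * exp ((2 * Y) ^ p - e * (Y ^ Suc p / 2))"
            by (simp add: mult_exp_exp)
          finally show ?thesis using Y by (simp add: M'_def)
        qed
      qed
      then show ?thesis by (simp add: ng)
    qed
    then have "\<forall>\<^sub>F e in at_right 0. norm (f s) * exp (- e * Re ((- \<i> * s) ^ Suc p)) \<le> M'"
      using eventually_at_right_less by (rule eventually_mono[rotated])
    moreover have "((\<lambda>e. norm (f s) * exp (- e * Re ((- \<i> * s) ^ Suc p))) \<longlongrightarrow> norm (f s) * exp (- 0 * Re ((- \<i> * s) ^ Suc p))) (at_right 0)"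
      by (intro tendsto_intros)
    ultimately have "norm (f s) * exp (- 0 * Re ((- \<i> * s) ^ Suc p)) \<le> M'"
      by (intro tendsto_upperbound) auto
    then show ?thesis by simp
  qed
  then show ?thesis by blast
qed

section \<open>Quotients of Gamma functions on vertical lines\<close>

text \<open>This takes the place of Stirling's formula. Each factor z + j of the remainder is
  bounded below by the geometric mean of Im z and roughly k, so the three factors give k powr
  (-3/2), which is summable, times Im z powr (-3/2), which is smaller than the main term. The
  half-plane Re z \<ge> -1 leaves room for the shifted line, where the Gamma arguments may have
  negative real part.\<close>

lemma Polygamma_1_asymptotic:
  "\<exists>C. \<forall>z. Re z \<ge> -1 \<longrightarrow> Im z \<ge> 1 \<longrightarrow> norm (Polygamma 1 z - 1 / z) \<le> C * Im z powr (-3/2)"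
proof -
  \<comment> \<open>Re (z + k) \<ge> k - 1 because Re z \<ge> -1; for small k the lower bound 1
    comes from Im z \<ge> 1 instead.\<close>
  define b where "b = (\<lambda>n::nat. max 1 (real n - 1) powr (-3/2))"
  have sb: "summable b"
  proof (rule summable_offset[where k = 2])
    have "summable (\<lambda>n::nat. real n powr (-3/2))" by (simp add: summable_real_powr_iff)
    then have "summable (\<lambda>n::nat. real (n + 1) powr (-3/2))" by (rule summable_ignore_initial_segment)
    then show "summable (\<lambda>n. b (n + 2))" by (simp add: b_def max_def)
  qed
  have "norm (Polygamma 1 z - 1 / z) \<le> suminf b * Im z powr (-3/2)" if z: "Re z \<ge> -1" "Im z \<ge> 1" for z
  proof -
    have nz: "z + of_nat n \<noteq> 0" for n using z by (auto simp: complex_eq_iff)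
    have 1: "(\<lambda>k. inverse ((z + of_nat k)\<^sup>2)) sums Polygamma 1 z"
      using summable_sums[OF Polygamma_converges'[of z 2]] nz[of 0] by (simp add: Polygamma_def numeral_2_eq_2)
    \<comment> \<open>\<open>1 / z\<close> is the telescoping sum of \<open>1 / ((z + k) * (z + k + 1))\<close>, close to \<open>1 / (z + k)\<^sup>2\<close>.\<close>
    have 2: "(\<lambda>k. inverse (z + of_nat k) - inverse (z + of_nat (Suc k))) sums (inverse (z + of_nat 0) - 0)"
      by (intro telescope_sums' filterlim_compose[OF tendsto_inverse_0]
              tendsto_add_filterlim_at_infinity[OF tendsto_const] tendsto_of_nat)
    have 3: "(\<lambda>k. inverse ((z + of_nat k)\<^sup>2 * (z + of_nat (Suc k)))) sums (Polygamma 1 z - 1 / z)"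
    proof -
      have "inverse ((z + of_nat k)\<^sup>2) - (inverse (z + of_nat k) - inverse (z + of_nat (Suc k))) =
         inverse ((z + of_nat k)\<^sup>2 * (z + of_nat (Suc k)))" for k
        using nz[of k] nz[of "Suc k"] by (simp add: divide_simps power2_eq_square)
      then show ?thesis using sums_diff[OF 1 2] by (simp add: inverse_eq_divide)
    qed
    have "norm (inverse ((z + of_nat k)\<^sup>2 * (z + of_nat (Suc k)))) \<le> b k * Im z powr (-3/2)" for k
    proof -
      define m where "m = max 1 (real k - 1)"
      have m: "m \<ge> 1" by (simp add: m_def)
      have l: "Im z \<le> norm (z + of_nat j)" for j using abs_Im_le_cmod[of "z + of_nat j"] z by simp
      have r: "m \<le> norm (z + of_nat j)" if "j \<ge> k" for j
        using abs_Re_le_cmod[of "z + of_nat j"] l[of j] z that by (auto simp: m_def)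
      have f: "sqrt (m * Im z) \<le> norm (z + of_nat j)" if "j \<ge> k" for j
      proof -
        have "m * Im z \<le> norm (z + of_nat j) * norm (z + of_nat j)"
          by (intro mult_mono l r that) (use z m in auto)
        then have "m * Im z \<le> (norm (z + of_nat j))\<^sup>2" by (simp only: power2_eq_square)
        then show ?thesis by (intro real_le_lsqrt norm_ge_zero)
      qed
      have p: "sqrt (m * Im z) > 0" using m z by simp
      have "(sqrt (m * Im z)) ^ 2 * sqrt (m * Im z) \<le> norm (z + of_nat k) ^ 2 * norm (z + of_nat (Suc k))"
        by (intro mult_mono power_mono f) (use p in auto)
      then have "inverse (norm (z + of_nat k) ^ 2 * norm (z + of_nat (Suc k))) \<le> inverse ((sqrt (m * Im z)) ^ 2 * sqrt (m * Im z))"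
        using p by (intro le_imp_inverse_le) auto
      also have "\<dots> = inverse ((m * Im z) powr 1 * (m * Im z) powr (1/2))"
        using m z by (simp add: powr_half_sqrt)
      also have "\<dots> = (m * Im z) powr (- 3/2)"
        unfolding powr_add[symmetric] by (simp add: powr_minus[symmetric])
      also have "\<dots> = b k * Im z powr (-3/2)"
        using m z by (subst powr_mult) (auto simp: b_def m_def)
      finally show ?thesis by (simp add: norm_inverse norm_mult norm_power)
    qed
    then have "norm (Polygamma 1 z - 1 / z) \<le> (\<Sum>k. b k * Im z powr (-3/2))"
      unfolding sums_unique[OF 3] by (intro norm_suminf_le summable_mult2 sb)
    then show ?thesis using suminf_mult2[OF sb] by simp
  qed
  then show ?thesis by blast
qed


text \<open>With derivatives written as f * l, the growth rates Re l and the frequencies Im l of the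
  factors simply add.\<close>

lemma has_vector_derivative_prod_logarithmic:
  fixes f :: "'i \<Rightarrow> real \<Rightarrow> complex"
  assumes "\<And>i. i \<in> I \<Longrightarrow> (f i has_vector_derivative f i t * l i) (at t within S)"
  shows "((\<lambda>t. \<Prod>i\<in>I. f i t) has_vector_derivative (\<Prod>i\<in>I. f i t) * (\<Sum>i\<in>I. l i)) (at t within S)"
  using assms
proof (induction I rule: infinite_finite_induct)
  case (insert i I)
  have "((\<lambda>t. f i t * (\<Prod>i\<in>I. f i t)) has_vector_derivative
      f i t * ((\<Prod>i\<in>I. f i t) * (\<Sum>i\<in>I. l i)) + f i t * l i * (\<Prod>i\<in>I. f i t)) (at t within S)"
    by (intro has_vector_derivative_mult insert.IH insert.prems) auto
  then show ?case using insert.hyps by (simp add: algebra_simps)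
qed auto

lemma Im_pos_notin_nonpos_Ints:
  "Im z > 0 \<Longrightarrow> z \<notin> \<int>\<^sub>\<le>\<^sub>0"
  by (auto elim!: nonpos_Ints_cases)

lemma Im_Polygamma_1_bounds:
  assumes "\<delta> > 0"
  shows "\<forall>\<^sub>F \<tau> in at_top. \<forall>x\<in>{-1..S}. (1 - \<delta>) / \<tau> \<le> - Im (Polygamma 1 (Complex x \<tau>)) \<and>
           - Im (Polygamma 1 (Complex x \<tau>)) \<le> (1 + \<delta>) / \<tau>"
proof -
  obtain C where C: "\<And>z. Re z \<ge> -1 \<Longrightarrow> Im z \<ge> 1 \<Longrightarrow> norm (Polygamma 1 z - 1 / z) \<le> C * Im z powr (-3/2)"
    using Polygamma_1_asymptotic by blast
  define M where "M = max 1 S"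
  have e1: "\<forall>\<^sub>F \<tau> in at_top. C * \<tau> powr (-3/2) \<le> (\<delta> / 2) / \<tau>"
  proof -
    have "((\<lambda>\<tau>. C * \<tau> powr (-3/2) * \<tau>) \<longlongrightarrow> 0) at_top" by real_asymp
    then have "\<forall>\<^sub>F \<tau> in at_top. C * \<tau> powr (-3/2) * \<tau> < \<delta> / 2"
      by (rule order_tendstoD(2)) (use assms in simp)
    then show ?thesis
      using eventually_gt_at_top[of 0] by eventually_elim (simp add: field_simps)
  qed
  have e2: "\<forall>\<^sub>F \<tau> in at_top. \<tau> * (\<tau> / (M\<^sup>2 + \<tau>\<^sup>2)) > 1 - \<delta> / 2"
  proof -
    have "((\<lambda>\<tau>. \<tau> * (\<tau> / (M\<^sup>2 + \<tau>\<^sup>2))) \<longlongrightarrow> 1) at_top" by real_asymp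
    then show ?thesis by (rule order_tendstoD(1)) (use assms in simp)
  qed
  show ?thesis
    using e1 e2 eventually_ge_at_top[of 1]
  proof eventually_elim
    case (elim \<tau>)
    show ?case
    proof
      fix x assume x: "x \<in> {-1..S}"
      let ?z = "Complex x \<tau>"
      have "\<bar>Im (Polygamma 1 ?z) + \<tau> / (x\<^sup>2 + \<tau>\<^sup>2)\<bar> = \<bar>Im (Polygamma 1 ?z - 1 / ?z)\<bar>"
        by (simp add: Im_divide)
      also have "\<dots> \<le> C * \<tau> powr (-3/2)"
        using C[of ?z] x elim abs_Im_le_cmod order_trans by fastforce
      finally have 1: "\<bar>Im (Polygamma 1 ?z) + \<tau> / (x\<^sup>2 + \<tau>\<^sup>2)\<bar> \<le> (\<delta> / 2) / \<tau>" using elim by linarith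
      have "\<bar>x\<bar> \<le> M" using x by (auto simp: M_def)
      then have "x\<^sup>2 \<le> M\<^sup>2" by (rule power2_le_iff_abs_le[THEN iffD2, rotated]) (simp add: M_def)
      then have "\<tau> / (x\<^sup>2 + \<tau>\<^sup>2) \<ge> \<tau> / (M\<^sup>2 + \<tau>\<^sup>2)"
        using elim by (intro divide_left_mono mult_pos_pos add_nonneg_pos) auto
      moreover have "\<tau> / (M\<^sup>2 + \<tau>\<^sup>2) \<ge> (1 - \<delta> / 2) / \<tau>"
      proof -
        have "(1 - \<delta> / 2) \<le> \<tau> / (M\<^sup>2 + \<tau>\<^sup>2) * \<tau>" using elim by (simp add: mult.commute)
        then show ?thesis using elim by (subst pos_divide_le_eq) auto
      qed
      moreover have "\<tau> / (x\<^sup>2 + \<tau>\<^sup>2) \<le> \<tau> / \<tau>\<^sup>2"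
        using elim by (intro divide_left_mono mult_pos_pos add_nonneg_pos) auto
      moreover have "\<tau> / \<tau>\<^sup>2 = 1 / \<tau>" by (simp add: power2_eq_square)
      moreover have "(1 - \<delta>) / \<tau> = (1 - \<delta> / 2) / \<tau> - (\<delta> / 2) / \<tau>" "(1 + \<delta>) / \<tau> = 1 / \<tau> + \<delta> / 2 / \<tau> + \<delta> / 2 / \<tau>"
        by (simp_all add: diff_divide_distrib add_divide_distrib)
      moreover have "\<delta> / 2 / \<tau> \<ge> 0" using assms elim by simp
      ultimately show "(1 - \<delta>) / \<tau> \<le> - Im (Polygamma 1 ?z) \<and> - Im (Polygamma 1 ?z) \<le> (1 + \<delta>) / \<tau>"
        using 1 unfolding abs_le_iff by linarith
    qed
  qed
qed

text \<open>The mean value theorem along a horizontal segment. Such a difference, multiplied by w,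
  is the growth rate of the modulus of one factor of the Gamma quotient.\<close>

lemma Im_Digamma_diff_bounds:
  assumes "0 < \<tau>" "\<sigma>2 < \<sigma>1"
    and "\<And>x. x \<in> {\<sigma>2..\<sigma>1} \<Longrightarrow> a \<le> - Im (Polygamma 1 (Complex x \<tau>)) \<and> - Im (Polygamma 1 (Complex x \<tau>)) \<le> b"
  shows "a * (\<sigma>1 - \<sigma>2) \<le> Im (Digamma (Complex \<sigma>2 \<tau>)) - Im (Digamma (Complex \<sigma>1 \<tau>))"
    and "Im (Digamma (Complex \<sigma>2 \<tau>)) - Im (Digamma (Complex \<sigma>1 \<tau>)) \<le> b * (\<sigma>1 - \<sigma>2)"
proof -
  have "((\<lambda>x. Im (Digamma (Complex x \<tau>))) has_real_derivative Im (Polygamma 1 (Complex x \<tau>))) (at x)" for x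
  proof -
    have "((\<lambda>x. of_real x + Complex 0 \<tau>) has_vector_derivative 1) (at x)"
      by (auto intro!: derivative_eq_intros)
    then have "((\<lambda>x. Digamma (of_real x + Complex 0 \<tau>)) has_vector_derivative 1 * Polygamma (Suc 0) (of_real x + Complex 0 \<tau>)) (at x)"
      by (rule field_vector_diff_chain_at[unfolded o_def])
         (intro has_field_derivative_Polygamma Im_pos_notin_nonpos_Ints, use assms in simp)
    moreover have "of_real x + Complex 0 \<tau> = Complex x \<tau>" for x by (simp add: complex_eq_iff)
    ultimately have "((\<lambda>x. Digamma (Complex x \<tau>)) has_vector_derivative Polygamma 1 (Complex x \<tau>)) (at x)" by simp
    then show ?thesis
      unfolding has_real_derivative_iff_has_vector_derivative
      by (rule bounded_linear.has_vector_derivative[OF bounded_linear_Im])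
  qed
  from MVT2[OF assms(2), of "\<lambda>x. Im (Digamma (Complex x \<tau>))", OF this]
  obtain z where z: "z > \<sigma>2" "z < \<sigma>1"
    "Im (Digamma (Complex \<sigma>1 \<tau>)) - Im (Digamma (Complex \<sigma>2 \<tau>)) = (\<sigma>1 - \<sigma>2) * Im (Polygamma 1 (Complex z \<tau>))"
    by blast
  then have eq: "Im (Digamma (Complex \<sigma>2 \<tau>)) - Im (Digamma (Complex \<sigma>1 \<tau>)) = - Im (Polygamma 1 (Complex z \<tau>)) * (\<sigma>1 - \<sigma>2)"
    by (simp add: algebra_simps)
  show "a * (\<sigma>1 - \<sigma>2) \<le> Im (Digamma (Complex \<sigma>2 \<tau>)) - Im (Digamma (Complex \<sigma>1 \<tau>))"
    "Im (Digamma (Complex \<sigma>2 \<tau>)) - Im (Digamma (Complex \<sigma>1 \<tau>)) \<le> b * (\<sigma>1 - \<sigma>2)"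
    unfolding eq by (intro mult_right_mono; use assms(2) assms(3)[of z] z in simp)+
qed

text \<open>The ratio of Gamma factors that the functional equation produces on Re s = -A. The
  reflected point 1 - cnj s has real part 1 + A and the same height t, so with the conjugate outside
  \<open>Gamma\<close> all arguments lie in the upper half-plane for large t.\<close>

definition gamma_quotient :: "real \<Rightarrow> nat \<Rightarrow> (nat \<Rightarrow> real) \<Rightarrow> (nat \<Rightarrow> complex) \<Rightarrow> real \<Rightarrow> complex" where
  "gamma_quotient A k w \<mu> t =
     (\<Prod>i<k. cnj (Gamma (of_real (w i) * Complex (1 + A) t + \<mu> i)) /
             Gamma (of_real (w i) * Complex (- A) t + \<mu> i))"

lemma has_vector_derivative_vertical_line:
  assumes "(f has_field_derivative f') (at (of_real w * Complex \<sigma> t + m))"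
  shows "((\<lambda>t. f (of_real w * Complex \<sigma> t + m)) has_vector_derivative \<i> * of_real w * f') (at t within S)"
proof -
  have "Complex \<sigma> t = of_real \<sigma> + \<i> * of_real t" for t by (simp add: complex_eq_iff)
  then have "((\<lambda>t. of_real w * Complex \<sigma> t + m) has_vector_derivative \<i> * of_real w) (at t)"
    by (auto intro!: derivative_eq_intros)
  from field_vector_diff_chain_at[OF this assms] show ?thesis
    unfolding o_def by (rule has_vector_derivative_at_within)
qed

text \<open>With \<open>gamma_quotient_freq\<close>, the real and imaginary part of the logarithmic
  derivative of one factor. The conjugation makes the imaginary parts of the two Digamma values
  cancel to leading order, so the modulus grows only polynomially, while the real parts add up, so
  the phase really oscillates.\<close>

definition gamma_quotient_growth :: "real \<Rightarrow> real \<Rightarrow> complex \<Rightarrow> real \<Rightarrow> real" where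
  "gamma_quotient_growth A w m t = w * (Im (Digamma (of_real w * Complex (- A) t + m)) - Im (Digamma (of_real w * Complex (1 + A) t + m)))"

definition gamma_quotient_freq :: "real \<Rightarrow> real \<Rightarrow> complex \<Rightarrow> real \<Rightarrow> real" where
  "gamma_quotient_freq A w m t = - w * (Re (Digamma (of_real w * Complex (1 + A) t + m)) + Re (Digamma (of_real w * Complex (- A) t + m)))"

definition gamma_quotient_freq' :: "real \<Rightarrow> real \<Rightarrow> complex \<Rightarrow> real \<Rightarrow> real" where
  "gamma_quotient_freq' A w m t = w\<^sup>2 * (Im (Polygamma 1 (of_real w * Complex (1 + A) t + m)) + Im (Polygamma 1 (of_real w * Complex (- A) t + m)))"

lemma gamma_quotient_factor_derivative:
  assumes "w * t + Im m > 0"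
  shows "((\<lambda>t. cnj (Gamma (of_real w * Complex (1 + A) t + m)) / Gamma (of_real w * Complex (- A) t + m))
     has_vector_derivative cnj (Gamma (of_real w * Complex (1 + A) t + m)) / Gamma (of_real w * Complex (- A) t + m) *
       Complex (gamma_quotient_growth A w m t) (gamma_quotient_freq A w m t)) (at t within S)"
proof -
  let ?z1 = "of_real w * Complex (1 + A) t + m" and ?z2 = "of_real w * Complex (- A) t + m"
  have ni: "?z1 \<notin> \<int>\<^sub>\<le>\<^sub>0" "?z2 \<notin> \<int>\<^sub>\<le>\<^sub>0" using assms by (auto intro!: Im_pos_notin_nonpos_Ints)
  have 1: "((\<lambda>t. cnj (Gamma (of_real w * Complex (1 + A) t + m))) has_vector_derivative
      cnj (\<i> * of_real w * (Gamma ?z1 * Digamma ?z1))) (at t within S)"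
    by (intro bounded_linear.has_vector_derivative[OF bounded_linear_cnj] has_vector_derivative_vertical_line
        has_field_derivative_Gamma ni)
  have 2: "((\<lambda>t. inverse (Gamma (of_real w * Complex (- A) t + m))) has_vector_derivative
      \<i> * of_real w * (- (Gamma ?z2 * Digamma ?z2) * inverse (Gamma ?z2 ^ 2))) (at t within S)"
    by (rule has_vector_derivative_vertical_line[where f = "\<lambda>z. inverse (Gamma z)"])
       (use ni in \<open>auto intro!: derivative_eq_intros simp: Gamma_eq_zero_iff field_simps power2_eq_square\<close>)
  have g2: "Gamma ?z2 \<noteq> 0" using ni by (simp add: Gamma_eq_zero_iff)
  have e: "Complex (gamma_quotient_growth A w m t) (gamma_quotient_freq A w m t) = cnj (\<i> * of_real w * Digamma ?z1) - \<i> * of_real w * Digamma ?z2"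
    by (simp add: complex_eq_iff gamma_quotient_growth_def gamma_quotient_freq_def algebra_simps)
  have "cnj (Gamma ?z1) * (\<i> * of_real w * (- (Gamma ?z2 * Digamma ?z2) * inverse (Gamma ?z2 ^ 2)))
     + cnj (\<i> * of_real w * (Gamma ?z1 * Digamma ?z1)) * inverse (Gamma ?z2)
     = cnj (Gamma ?z1) * inverse (Gamma ?z2) * Complex (gamma_quotient_growth A w m t) (gamma_quotient_freq A w m t)"
    unfolding e using g2 by (simp add: field_simps power2_eq_square)
  then show ?thesis
    using has_vector_derivative_mult[OF 1 2] by (simp only: divide_inverse)
qed

lemma gamma_quotient_freq_derivative:
  assumes "w * t + Im m > 0"
  shows "(gamma_quotient_freq A w m has_real_derivative gamma_quotient_freq' A w m t) (at t within S)"
proof -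
  have d: "((\<lambda>t. Re (Digamma (of_real w * Complex \<sigma> t + m))) has_real_derivative
      - w * Im (Polygamma 1 (of_real w * Complex \<sigma> t + m))) (at t within S)" for \<sigma>
  proof -
    have "((\<lambda>t. Digamma (of_real w * Complex \<sigma> t + m)) has_vector_derivative
       \<i> * of_real w * Polygamma (Suc 0) (of_real w * Complex \<sigma> t + m)) (at t within S)"
      by (intro has_vector_derivative_vertical_line has_field_derivative_Polygamma Im_pos_notin_nonpos_Ints)
         (use assms in simp)
    from bounded_linear.has_vector_derivative[OF bounded_linear_Re this]
    show ?thesis by (simp add: has_real_derivative_iff_has_vector_derivative)
  qed
  have "gamma_quotient_freq A w m = (\<lambda>t. - w * (Re (Digamma (of_real w * Complex (1 + A) t + m)) + Re (Digamma (of_real w * Complex (- A) t + m))))"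
    by (simp add: fun_eq_iff gamma_quotient_freq_def)
  moreover have "((\<lambda>t. - w * (Re (Digamma (of_real w * Complex (1 + A) t + m)) + Re (Digamma (of_real w * Complex (- A) t + m))))
      has_real_derivative - w * (- w * Im (Polygamma 1 (of_real w * Complex (1 + A) t + m)) + - w * Im (Polygamma 1 (of_real w * Complex (- A) t + m)))) (at t within S)"
    by (intro DERIV_cmult DERIV_add d)
  ultimately show ?thesis by (simp add: gamma_quotient_freq'_def power2_eq_square algebra_simps)
qed

text \<open>The two arguments are w * (1 + 2 * A) apart at height about w * t, so the growth rate is
  asymptotic to w * (1 + 2 * A) / t. The derivative of the frequency is asymptotic to -2 * w / t, of
  which a quarter is kept. The conditions on w * A and Re m keep the left argument in Re z \<ge>
  -1.\<close>

lemma gamma_quotient_log_derivative_bounds: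
  assumes w: "w > 0" and A: "A > 0" "w * A \<le> 1" and m: "Re m \<ge> 0" and \<eta>: "\<eta> > w * (1 + 2 * A)"
  shows "\<forall>\<^sub>F t in at_top. w * t + Im m \<ge> 1 \<and> 0 \<le> gamma_quotient_growth A w m t \<and> gamma_quotient_growth A w m t \<le> \<eta> / t \<and>
           gamma_quotient_freq' A w m t \<le> - (w / 2) / t"
proof -
  define \<sigma>1 where "\<sigma>1 = w * (1 + A) + Re m"
  define \<sigma>2 where "\<sigma>2 = - w * A + Re m"
  have sig: "\<sigma>2 \<ge> -1" "\<sigma>2 < \<sigma>1" "\<sigma>1 - \<sigma>2 = w * (1 + 2 * A)"
    using w A m by (auto simp: \<sigma>1_def \<sigma>2_def algebra_simps add_pos_pos)
  have p: "w * (1 + 2 * A) > 0" using w A by simp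
  have eta': "\<eta> / (w * (1 + 2 * A)) > 1" using p \<eta> by simp
  \<comment> \<open>1/2 is what the frequency bound needs; the other condition makes the growth rate
    stay below \<eta> / t.\<close>
  have "\<exists>\<delta>>0. \<delta> \<le> 1/2 \<and> 1 + \<delta> < r" if "r > 1" for r :: real
    using that by (intro exI[of _ "min (1/2) ((r - 1) / 2)"]) (auto simp: min_def field_simps)
  from this[OF eta'] obtain \<delta> where \<delta>: "\<delta> > 0" "\<delta> \<le> 1/2" "1 + \<delta> < \<eta> / (w * (1 + 2 * A))"
    by blast
  have lim: "filterlim (\<lambda>t. w * t + Im m) at_top at_top" using w by real_asymp
  have ev1: "\<forall>\<^sub>F t in at_top. \<forall>x\<in>{-1..\<sigma>1}. (1 - \<delta>) / (w * t + Im m) \<le> - Im (Polygamma 1 (Complex x (w * t + Im m))) \<and>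
           - Im (Polygamma 1 (Complex x (w * t + Im m))) \<le> (1 + \<delta>) / (w * t + Im m)"
    using Im_Polygamma_1_bounds[OF \<delta>(1)] lim by (rule eventually_compose_filterlim)
  have ev2: "\<forall>\<^sub>F t in at_top. w * t + Im m \<ge> 1"
    using lim by (simp add: filterlim_at_top)
  have ev3: "\<forall>\<^sub>F t in at_top. w * t + Im m \<le> 2 * w * t"
    using w by real_asymp
  have ev4: "\<forall>\<^sub>F t in at_top. w * (1 + \<delta>) * (w * (1 + 2 * A)) / (w * t + Im m) * t \<le> \<eta>"
  proof -
    have "((\<lambda>t. w * (1 + \<delta>) * (w * (1 + 2 * A)) / (w * t + Im m) * t) \<longlongrightarrow> w * (1 + \<delta>) * (w * (1 + 2 * A)) / w) at_top"
      using w by real_asymp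
    moreover have "w * (1 + \<delta>) * (w * (1 + 2 * A)) / w < \<eta>"
      using \<delta>(3) p w by (simp add: pos_less_divide_eq)
    ultimately have "\<forall>\<^sub>F t in at_top. w * (1 + \<delta>) * (w * (1 + 2 * A)) / (w * t + Im m) * t < \<eta>"
      by (rule order_tendstoD(2))
    then show ?thesis by eventually_elim simp
  qed
  show ?thesis
    using ev1 ev2 ev3 ev4 eventually_gt_at_top[of 0]
  proof eventually_elim
    case (elim t)
    define \<tau> where "\<tau> = w * t + Im m"
    have \<tau>: "\<tau> \<ge> 1" using elim by (simp add: \<tau>_def)
    have z1: "of_real w * Complex (1 + A) t + m = Complex \<sigma>1 \<tau>"
      and z2: "of_real w * Complex (- A) t + m = Complex \<sigma>2 \<tau>"
      by (auto simp: complex_eq_iff \<sigma>1_def \<sigma>2_def \<tau>_def)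
    have b: "(1 - \<delta>) / \<tau> \<le> - Im (Polygamma 1 (Complex x \<tau>)) \<and> - Im (Polygamma 1 (Complex x \<tau>)) \<le> (1 + \<delta>) / \<tau>"
      if "x \<in> {\<sigma>2..\<sigma>1}" for x using elim(1) that sig by (auto simp: \<tau>_def)
    note dd = Im_Digamma_diff_bounds[OF _ sig(2) b]
    have "0 \<le> (1 - \<delta>) / \<tau> * (\<sigma>1 - \<sigma>2)" using \<delta> \<tau> sig by simp
    then have "0 \<le> gamma_quotient_growth A w m t"
      unfolding gamma_quotient_growth_def z1 z2 using dd(1) \<tau> w by simp
    moreover have "gamma_quotient_growth A w m t \<le> \<eta> / t"
    proof -
      have "gamma_quotient_growth A w m t \<le> w * ((1 + \<delta>) / \<tau> * (\<sigma>1 - \<sigma>2))"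
        unfolding gamma_quotient_growth_def z1 z2 using dd(2) \<tau> w by (intro mult_left_mono) auto
      also have "\<dots> = w * (1 + \<delta>) * (w * (1 + 2 * A)) / \<tau>"
        unfolding sig(3) by simp
      also have "\<dots> \<le> \<eta> / t" using elim by (simp add: \<tau>_def pos_le_divide_eq)
      finally show ?thesis .
    qed
    moreover have "gamma_quotient_freq' A w m t \<le> - (w / 2) / t"
    proof -
      have "(1 - \<delta>) / \<tau> \<ge> (1/2) / \<tau>" using \<delta> \<tau> by (intro divide_right_mono) auto
      then have "Im (Polygamma 1 (Complex \<sigma>1 \<tau>)) + Im (Polygamma 1 (Complex \<sigma>2 \<tau>)) \<le> - (1 / \<tau>)"
        using b[of \<sigma>1] b[of \<sigma>2] sig(2) by simp
      then have "gamma_quotient_freq' A w m t \<le> w\<^sup>2 * (- (1 / \<tau>))"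
        unfolding gamma_quotient_freq'_def z1 z2 by (intro mult_left_mono) auto
      also have "\<dots> \<le> w\<^sup>2 * (- (1 / (2 * w * t)))"
        using elim w \<tau> by (intro mult_left_mono le_imp_neg_le divide_left_mono mult_pos_pos) (auto simp: \<tau>_def)
      also have "\<dots> = - (w / 2) / t" using w elim by (simp add: power2_eq_square)
      finally show ?thesis .
    qed
    ultimately show ?case using \<tau> by (simp add: \<tau>_def)
  qed
qed

text \<open>The integral bound is uniform in x because a linear phase does not change the second
  derivative; thus one estimate serves all terms of the Dirichlet series. It needs k > 0: the empty
  product is 1, which does not oscillate.\<close>

lemma gamma_quotient_estimates:
  assumes w: "\<And>i. i < k \<Longrightarrow> w i > 0 \<and> w i * A \<le> 1 \<and> Re (\<mu> i) \<ge> 0" and A: "A > 0"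
    and \<kappa>: "(\<Sum>i<k. w i) * (1 + 2 * A) < \<kappa>"
  obtains T0 C where "T0 \<ge> 1" "C > 0"
    "\<And>i t. i < k \<Longrightarrow> t \<ge> T0 \<Longrightarrow> w i * t + Im (\<mu> i) \<ge> 1"
    "continuous_on {T0..} (gamma_quotient A k w \<mu>)"
    "\<And>t. t \<ge> T0 \<Longrightarrow> norm (gamma_quotient A k w \<mu> t) \<le> C * t powr \<kappa>"
    "\<And>x T. k > 0 \<Longrightarrow> T \<ge> T0 \<Longrightarrow>
        norm (integral {T0..T} (\<lambda>t. gamma_quotient A k w \<mu> t * cis (x * t))) \<le> C * T powr (\<kappa> + 1/2)"
proof -
  \<comment> \<open>The slack between \<kappa> and the true exponent, shared out among the k
    factors; k + 1 keeps the denominator positive for k = 0.\<close>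
  define e where "e = (\<kappa> - (\<Sum>i<k. w i) * (1 + 2 * A)) / (real k + 1)"
  have e: "e > 0" using \<kappa> by (simp add: e_def)
  have sum_le: "(\<Sum>i<k. w i * (1 + 2 * A) + e) \<le> \<kappa>"
  proof -
    have "(\<Sum>i<k. w i * (1 + 2 * A) + e) = (\<Sum>i<k. w i) * (1 + 2 * A) + real k * e"
      by (simp add: sum.distrib sum_distrib_right)
    also have "\<dots> \<le> (\<Sum>i<k. w i) * (1 + 2 * A) + (real k + 1) * e" using e by simp
    also have "\<dots> = \<kappa>" by (simp add: e_def)
    finally show ?thesis .
  qed
  have "\<forall>\<^sub>F t in at_top. \<forall>i\<in>{..<k}. w i * t + Im (\<mu> i) \<ge> 1 \<and> 0 \<le> gamma_quotient_growth A (w i) (\<mu> i) t \<and>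
      gamma_quotient_growth A (w i) (\<mu> i) t \<le> (w i * (1 + 2 * A) + e) / t \<and> gamma_quotient_freq' A (w i) (\<mu> i) t \<le> - (w i / 2) / t"
    by (intro eventually_ball_finite ballI gamma_quotient_log_derivative_bounds) (use w A e in auto)
  then obtain T1 where T1: "\<And>t i. t \<ge> T1 \<Longrightarrow> i < k \<Longrightarrow> w i * t + Im (\<mu> i) \<ge> 1 \<and> 0 \<le> gamma_quotient_growth A (w i) (\<mu> i) t \<and>
      gamma_quotient_growth A (w i) (\<mu> i) t \<le> (w i * (1 + 2 * A) + e) / t \<and> gamma_quotient_freq' A (w i) (\<mu> i) t \<le> - (w i / 2) / t"
    unfolding eventually_at_top_linorder by auto
  define T0 where "T0 = max 1 T1"
  have T0: "T0 \<ge> 1" "T0 \<ge> T1" by (auto simp: T0_def)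
  define R where "R = gamma_quotient A k w \<mu>"
  define \<rho> where "\<rho> = (\<lambda>t. \<Sum>i<k. gamma_quotient_growth A (w i) (\<mu> i) t)"
  define \<phi> where "\<phi> = (\<lambda>t. \<Sum>i<k. gamma_quotient_freq A (w i) (\<mu> i) t)"
  define \<phi>' where "\<phi>' = (\<lambda>t. \<Sum>i<k. gamma_quotient_freq' A (w i) (\<mu> i) t)"
  define W where "W = (\<Sum>i<k. w i)"
  have tau: "w i * t + Im (\<mu> i) \<ge> 1" if "i < k" "t \<ge> T0" for i t using T1[of t i] that T0 by simp
  have tau': "w i * t + Im (\<mu> i) > 0" if "i < k" "t \<ge> T0" for i t using tau[OF that] by simp
  have Csum: "(\<Sum>i<k. Complex (x i) (y i)) = Complex (\<Sum>i<k. x i) (\<Sum>i<k. y i)" for x y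
    by (simp add: complex_eq_iff Re_sum Im_sum)
  have dR: "(R has_vector_derivative R t * Complex (\<rho> t) (\<phi> t)) (at t within S)" if "t \<ge> T0" for t S
    unfolding R_def gamma_quotient_def \<rho>_def \<phi>_def Csum[symmetric]
    by (rule has_vector_derivative_prod_logarithmic)
       (intro gamma_quotient_factor_derivative, use tau' that in auto)
  have dphi: "(\<phi> has_real_derivative \<phi>' t) (at t within S)" if "t \<ge> T0" for t S
    unfolding \<phi>_def \<phi>'_def by (intro DERIV_sum gamma_quotient_freq_derivative) (use tau' that in auto)
  have nz: "R t \<noteq> 0" if "t \<ge> T0" for t
    unfolding R_def gamma_quotient_def
    using tau'[OF _ that] by (auto simp: Gamma_eq_zero_iff intro!: Im_pos_notin_nonpos_Ints)
  have rho0: "\<rho> t \<ge> 0" if "t \<ge> T0" for t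
    unfolding \<rho>_def by (intro sum_nonneg) (use T1[of t] T0 that in auto)
  have rho: "\<rho> t \<le> \<kappa> / t" if "t \<ge> T0" for t
  proof -
    have "\<rho> t \<le> (\<Sum>i<k. (w i * (1 + 2 * A) + e) / t)"
      unfolding \<rho>_def by (intro sum_mono) (use T1[of t] T0 that in auto)
    also have "\<dots> = (\<Sum>i<k. w i * (1 + 2 * A) + e) / t" by (rule sum_divide_distrib[symmetric])
    also have "\<dots> \<le> \<kappa> / t" using sum_le T0 that by (intro divide_right_mono) auto
    finally show ?thesis .
  qed
  have phi': "\<phi>' t \<le> - (W / 2) / t" if "t \<ge> T0" for t
  proof -
    have "\<phi>' t \<le> (\<Sum>i<k. - (w i / 2) / t)"
      unfolding \<phi>'_def by (intro sum_mono) (use T1[of t] T0 that in auto)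
    also have "\<dots> = - (W / 2) / t" by (simp add: W_def sum_divide_distrib sum_negf)
    finally show ?thesis .
  qed
  \<comment> \<open>\<open>norm (R t) * t powr (- \<kappa>)\<close> is decreasing, since the logarithmic derivative of \<open>norm R\<close> is at most \<open>\<kappa> / t\<close>.\<close>
  define C0 where "C0 = norm (R T0) * T0 powr (- \<kappa>)"
  have C0: "C0 > 0" using nz[of T0] T0 by (simp add: C0_def)
  have R_le: "norm (R t) \<le> C0 * t powr \<kappa>" if t: "t \<ge> T0" for t
  proof -
    have "norm (R t) * t powr (- \<kappa>) \<le> norm (R T0) * T0 powr (- \<kappa>)"
    proof (rule DERIV_nonpos_imp_nonincreasing[OF t])
      fix x assume x: "T0 \<le> x" "x \<le> t"
      then have x0: "x > 0" using T0 by simp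
      have "((\<lambda>t. norm (R t) * t powr (- \<kappa>)) has_real_derivative
          norm (R x) * (- \<kappa> * x powr (- \<kappa> - 1)) + norm (R x) * \<rho> x * x powr (- \<kappa>)) (at x)"
        using has_real_derivative_norm_complex[OF dR[OF x(1)] nz[OF x(1)], of UNIV] x0
        by (auto intro!: derivative_eq_intros)
      moreover have "norm (R x) * (- \<kappa> * x powr (- \<kappa> - 1)) + norm (R x) * \<rho> x * x powr (- \<kappa>)
          = norm (R x) * x powr (- \<kappa>) * (\<rho> x - \<kappa> / x)"
        using x0 by (simp add: powr_diff algebra_simps)
      moreover have "norm (R x) * x powr (- \<kappa>) * (\<rho> x - \<kappa> / x) \<le> 0"
        using rho[OF x(1)] by (intro mult_nonneg_nonpos) auto
      ultimately show "\<exists>y. ((\<lambda>t. norm (R t) * t powr (- \<kappa>)) has_real_derivative y) (at x) \<and> y \<le> 0" by auto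
    qed
    then have "norm (R t) / t powr \<kappa> \<le> C0" by (simp add: C0_def powr_minus divide_inverse)
    then show ?thesis using t T0 by (simp add: pos_divide_le_eq)
  qed
  \<comment> \<open>One constant for both bounds. For k = 0 the quotient by sqrt 0 has the value 0,
    so that \<open>C\<close> is \<open>C0\<close>.\<close>
  define C where "C = C0 * (1 + 10 / sqrt (W / 2))"
  have W0: "W \<ge> 0" unfolding W_def by (intro sum_nonneg) (use w in force)
  have C: "C0 \<le> C" using C0 W0 by (simp add: C_def)
  show ?thesis
  proof (rule that[of T0 C])
    show "T0 \<ge> 1" by fact
    show "C > 0" using C C0 by simp
    show "w i * t + Im (\<mu> i) \<ge> 1" if "i < k" "t \<ge> T0" for i t using tau[OF that] .
    show "continuous_on {T0..} (gamma_quotient A k w \<mu>)"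
      unfolding R_def[symmetric] by (rule continuous_on_vector_derivative[OF dR]) simp
    show "norm (gamma_quotient A k w \<mu> t) \<le> C * t powr \<kappa>" if "t \<ge> T0" for t
    proof -
      have "C0 * t powr \<kappa> \<le> C * t powr \<kappa>" using C by (intro mult_right_mono) auto
      then show ?thesis using R_le[OF that] by (simp add: R_def)
    qed
    fix x T :: real assume k: "k > 0" and T: "T \<ge> T0"
    have Wp: "W > 0" unfolding W_def by (intro sum_pos) (use k w in auto)
    have T': "T > 0" using T T0 by simp
    \<comment> \<open>The phase is least curved at the right end, so its value there bounds it on
      the whole interval. The modulus is also largest there, and 1 / sqrt lam contributes the extra
      T powr (1/2).\<close>
    define lam where "lam = W / 2 / T"
    have lam: "lam > 0" using Wp T' by (simp add: lam_def)
    have "norm (integral {T0..T} (\<lambda>t. R t * cis (x * t))) \<le> 10 / sqrt lam * norm (R T * cis (x * T))"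
    proof (rule second_derivative_test[OF T lam, where \<rho> = \<rho> and \<phi> = "\<lambda>t. \<phi> t + x" and \<phi>' = \<phi>'])
      fix t assume t: "t \<in> {T0..T}"
      have "((\<lambda>t. cis (x * t)) has_vector_derivative \<i> * x * cis (x * t)) (at t within {T0..T})"
      proof -
        have "((\<lambda>t. exp (\<i> * of_real x * of_real t)) has_vector_derivative \<i> * x * exp (\<i> * of_real x * of_real t)) (at t within {T0..T})"
          by (auto intro!: derivative_eq_intros has_vector_derivative_real_field)
        then show ?thesis by (simp add: cis_conv_exp mult.assoc)
      qed
      then have "((\<lambda>t. R t * cis (x * t)) has_vector_derivative R t * (\<i> * x * cis (x * t)) + R t * Complex (\<rho> t) (\<phi> t) * cis (x * t)) (at t within {T0..T})"
        using t by (intro has_vector_derivative_mult dR) auto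
      moreover have "Complex (\<rho> t) (\<phi> t + x) = Complex (\<rho> t) (\<phi> t) + \<i> * x" by (simp add: complex_eq_iff)
      ultimately show "((\<lambda>t. R t * cis (x * t)) has_vector_derivative R t * cis (x * t) * Complex (\<rho> t) (\<phi> t + x)) (at t within {T0..T})"
        by (simp add: algebra_simps)
      show "((\<lambda>t. \<phi> t + x) has_real_derivative \<phi>' t) (at t within {T0..T})"
        using DERIV_add[OF dphi DERIV_const] t by fastforce
      show "\<rho> t \<ge> 0" "R t * cis (x * t) \<noteq> 0" using rho0 nz t by auto
      have "W / 2 / T \<le> W / 2 / t" using t T0 Wp by (intro divide_left_mono) auto
      then show "\<phi>' t \<le> - lam" using phi'[of t] t by (simp add: lam_def)
    qed
    also have "\<dots> \<le> 10 / sqrt lam * (C0 * T powr \<kappa>)"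
      using R_le[OF T] lam by (simp add: norm_mult mult_left_mono divide_right_mono)
    also have "\<dots> = C0 * (10 / sqrt (W / 2)) * T powr (\<kappa> + 1/2)"
      using T' by (simp add: lam_def real_sqrt_divide real_sqrt_mult powr_add powr_half_sqrt)
    also have "\<dots> \<le> C * T powr (\<kappa> + 1/2)"
      using C0 by (intro mult_right_mono) (auto simp: C_def algebra_simps)
    finally show "norm (integral {T0..T} (\<lambda>t. gamma_quotient A k w \<mu> t * cis (x * t))) \<le> C * T powr (\<kappa> + 1/2)"
      by (simp add: R_def)
  qed
qed

section \<open>Coefficients of Dirichlet series as mean values\<close>

lemma of_nat_powr_Complex:
  assumes "n > 0"
  shows "(of_nat n :: complex) powr Complex \<sigma> t = of_real (real n powr \<sigma>) * cis (ln (real n) * t)"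
proof -
  have "(of_nat n :: complex) = of_real (real n)" by simp
  then have "(of_nat n :: complex) powr Complex \<sigma> t = exp (Complex \<sigma> t * of_real (ln (real n)))"
    using assms by (simp add: powr_def Ln_of_real)
  also have "\<dots> = of_real (exp (\<sigma> * ln (real n))) * cis (ln (real n) * t)"
    unfolding exp_eq_polar by (simp add: mult.commute)
  finally show ?thesis using assms by (simp add: powr_def)
qed

lemma of_real_powr_Complex:
  assumes "Q > 0"
  shows "of_real Q powr Complex \<sigma> t = of_real (Q powr \<sigma>) * cis (ln Q * t)"
  using assms by (simp add: powr_def Ln_of_real exp_eq_polar mult.commute)

lemma dirichlet_sums_Complex:
  "dirichlet_sums a (Complex \<sigma> t) S \<longleftrightarrow>
     (\<lambda>n. a (Suc n) * of_real (real (Suc n) powr (- \<sigma>)) * cis (- ln (real (Suc n)) * t)) sums S"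
proof -
  have "- Complex \<sigma> t = Complex (- \<sigma>) (- t)" by (simp add: complex_eq_iff)
  then show ?thesis
    unfolding dirichlet_sums_def by (simp add: of_nat_powr_Complex mult.assoc del: of_nat_Suc)
qed

lemma bigo_powr_imp_bound:
  assumes "(\<lambda>n. norm (a n :: complex)) \<in> O(\<lambda>n. real n powr \<theta>)"
  obtains C where "C \<ge> 0" "\<And>n. n > 0 \<Longrightarrow> norm (a n) \<le> C * real n powr \<theta>"
proof -
  obtain c where c: "\<forall>\<^sub>F n in sequentially. norm (a n) \<le> c * real n powr \<theta>"
    using landau_o.bigE[OF assms] by auto
  then obtain N where N: "\<And>n. n \<ge> N \<Longrightarrow> norm (a n) \<le> c * real n powr \<theta>"
    unfolding eventually_sequentially by blast
  define C where "C = max c 0 + (\<Sum>n<N. norm (a n) / real n powr \<theta>)"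
  have s0: "(\<Sum>n<N. norm (a n) / real n powr \<theta>) \<ge> 0" by (intro sum_nonneg) auto
  have "norm (a n) \<le> C * real n powr \<theta>" if n: "n > 0" for n
  proof -
    have "norm (a n) / real n powr \<theta> \<le> C"
    proof (cases "n < N")
      case True
      then have "norm (a n) / real n powr \<theta> \<le> (\<Sum>n<N. norm (a n) / real n powr \<theta>)"
        by (intro member_le_sum) auto
      then show ?thesis by (simp add: C_def)
    next
      case False
      then have "norm (a n) / real n powr \<theta> \<le> c" using N[of n] n by (simp add: pos_divide_le_eq)
      then show ?thesis using s0 by (simp add: C_def)
    qed
    then show ?thesis using n by (simp add: pos_divide_le_eq)
  qed
  moreover have "C \<ge> 0" using s0 by (simp add: C_def)
  ultimately show ?thesis using that by blast
qed

lemma summable_dirichlet_bigo: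
  assumes "(\<lambda>n. norm (a n :: complex)) \<in> O(\<lambda>n. real n powr \<theta>)" "\<sigma> - \<theta> > 1"
  shows "summable (\<lambda>n. norm (a (Suc n)) * real (Suc n) powr (- \<sigma>))"
proof -
  obtain C where C: "C \<ge> 0" "\<And>n. n > 0 \<Longrightarrow> norm (a n) \<le> C * real n powr \<theta>"
    using bigo_powr_imp_bound[OF assms(1)] by blast
  have "summable (\<lambda>n. real n powr (\<theta> - \<sigma>))" using assms(2) by (simp add: summable_real_powr_iff)
  then have "summable (\<lambda>n. C * real (Suc n) powr (\<theta> - \<sigma>))"
    by (intro summable_mult) (rule summable_Suc_iff[THEN iffD2])
  then show ?thesis
  proof (rule summable_comparison_test')
    fix n
    have "norm (a (Suc n)) * real (Suc n) powr (- \<sigma>) \<le> C * real (Suc n) powr \<theta> * real (Suc n) powr (- \<sigma>)"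
      by (intro mult_right_mono C) auto
    then show "norm (norm (a (Suc n)) * real (Suc n) powr (- \<sigma>)) \<le> C * real (Suc n) powr (\<theta> - \<sigma>)"
      by (simp add: mult.assoc powr_add[symmetric] abs_mult del: of_nat_Suc)
  qed
qed

text \<open>With one primitive for two vertical lines, moving the line of integration amounts to
  comparing values of the primitive at the end points.\<close>

lemma integral_vertical_segment:
  assumes P: "\<And>s. Im s > 0 \<Longrightarrow> (P has_field_derivative g s) (at s)"
    and T: "0 < T0" "T0 \<le> T"
  shows "\<i> * integral {T0..T} (\<lambda>t. g (Complex \<sigma> t)) = P (Complex \<sigma> T) - P (Complex \<sigma> T0)"
proof -
  have "((\<lambda>t. \<i> * g (Complex \<sigma> t)) has_integral P (Complex \<sigma> T) - P (Complex \<sigma> T0)) {T0..T}"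
  proof (rule fundamental_theorem_of_calculus[OF T(2)])
    fix x assume "x \<in> {T0..T}"
    then show "((\<lambda>t. P (Complex \<sigma> t)) has_vector_derivative \<i> * g (Complex \<sigma> x)) (at x within {T0..T})"
      using has_vector_derivative_vertical_line[of P "g (Complex \<sigma> x)" 1 \<sigma> x 0] P[of "Complex \<sigma> x"] T by simp
  qed
  then have "integral {T0..T} (\<lambda>t. \<i> * g (Complex \<sigma> t)) = P (Complex \<sigma> T) - P (Complex \<sigma> T0)"
    by (rule integral_unique)
  then show ?thesis by simp
qed

text \<open>Dividing by a power of s makes \<open>F\<close> bounded on both sides of the strip, and
  Phragmen-Lindelof carries this inside. No interpolation of exponents is required, as the exponent
  of the left side is already below 1 in the application.\<close>

lemma polynomial_growth_half_strip:
  assumes A: "A > 0" and \<kappa>: "0 \<le> \<kappa>" and T0: "T0 \<ge> 1"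
    and hol: "F holomorphic_on {s. Im s > 0}"
    and growth: "\<And>s. - A \<le> Re s \<Longrightarrow> Re s \<le> 2 \<Longrightarrow> Im s \<ge> 1 \<Longrightarrow> norm (F s) \<le> C * exp (norm s ^ p)"
    and left: "\<And>t. t \<ge> T0 \<Longrightarrow> norm (F (Complex (- A) t)) \<le> M * t powr \<kappa>"
    and right: "\<And>t. t \<ge> T0 \<Longrightarrow> norm (F (Complex 2 t)) \<le> M"
  obtains B where "\<And>s. - A \<le> Re s \<Longrightarrow> Re s \<le> 2 \<Longrightarrow> Im s \<ge> T0 \<Longrightarrow> norm (F s) \<le> B * Im s powr \<kappa>"
proof -
  \<comment> \<open>-\<i> * s has positive real part in the upper half-plane, so the principal power
    is holomorphic there, and it has the modulus of the power of s.\<close>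
  define f where "f = (\<lambda>s. F s * (- \<i> * s) powr of_real (- \<kappa>))"
  have nf: "norm (f s) = norm (F s) * norm s powr (- \<kappa>)" for s
    unfolding f_def norm_mult by (subst norm_powr_real_powr') (auto simp: norm_mult)
  have M0: "M \<ge> 0" using right[of T0] norm_ge_zero order_trans by blast
  have n1: "norm s \<ge> Im s" for s using abs_Im_le_cmod[of s] by simp
  have n0: "norm s powr (- \<kappa>) \<le> 1" if "Im s \<ge> 1" for s
  proof -
    have "norm s \<ge> 1" using n1[of s] that by simp
    then show ?thesis using \<kappa> by (simp add: powr_minus ge_one_powr_ge_zero inverse_le_1_iff)
  qed
  have nle: "norm (f s) \<le> norm (F s)" if "Im s \<ge> 1" for s
    unfolding nf using n0[OF that] mult_left_mono[OF _ norm_ge_zero] by fastforce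
  have "\<exists>M'. \<forall>s. - A \<le> Re s \<longrightarrow> Re s \<le> 2 \<longrightarrow> Im s \<ge> T0 \<longrightarrow> norm (f s) \<le> M'"
  proof (rule phragmen_lindelof_half_strip)
    show "- A < 2" "T0 > 0" using A T0 by auto
    show "f holomorphic_on {s. Im s > 0}"
      unfolding f_def by (intro holomorphic_intros hol) (auto simp: complex_nonpos_Reals_iff)
    show "norm (f s) \<le> C * exp (norm s ^ p)" if "- A \<le> Re s" "Re s \<le> 2" "T0 \<le> Im s" for s
      using nle[of s] growth[of s] that T0 by linarith
    show "norm (f (Complex 2 t)) \<le> M" if "T0 \<le> t" for t
      using nle[of "Complex 2 t"] right[of t] that T0 by simp
    show "norm (f (Complex (- A) t)) \<le> M" if t: "T0 \<le> t" for t
    proof -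
      have "norm (Complex (- A) t) powr (- \<kappa>) \<le> t powr (- \<kappa>)"
        using n1[of "Complex (- A) t"] t T0 \<kappa> by (intro powr_mono2') auto
      then have "norm (f (Complex (- A) t)) \<le> (M * t powr \<kappa>) * t powr (- \<kappa>)"
        unfolding nf by (intro mult_mono left t) (use M0 in auto)
      also have "\<dots> = M" using t T0 by (simp add: powr_minus)
      finally show ?thesis .
    qed
  qed
  then obtain M' where M': "\<And>s. - A \<le> Re s \<Longrightarrow> Re s \<le> 2 \<Longrightarrow> Im s \<ge> T0 \<Longrightarrow> norm (f s) \<le> M'" by blast
  have "norm (F s) \<le> (M' * (3 + A) powr \<kappa>) * Im s powr \<kappa>" if s: "- A \<le> Re s" "Re s \<le> 2" "Im s \<ge> T0" for s
  proof -
    have sp: "norm s > 0" using n1[of s] s T0 by linarith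
    have M'0: "M' \<ge> 0" using M'[OF s] norm_ge_zero order_trans by blast
    have "norm s \<le> \<bar>Re s\<bar> + \<bar>Im s\<bar>" by (rule cmod_le)
    also have "\<dots> \<le> (2 + A) * 1 + Im s" using s A T0 by auto
    also have "\<dots> \<le> (2 + A) * Im s + Im s" using s A T0 by (intro add_right_mono mult_left_mono) auto
    finally have "norm s \<le> (3 + A) * Im s" by (simp add: algebra_simps)
    then have le: "norm s powr \<kappa> \<le> ((3 + A) * Im s) powr \<kappa>" using \<kappa> by (intro powr_mono2) auto
    have "norm (F s) = norm (f s) * norm s powr \<kappa>" using sp by (simp add: nf powr_minus)
    also have "\<dots> \<le> M' * ((3 + A) * Im s) powr \<kappa>"
      by (intro mult_mono M' s le M'0) auto
    also have "\<dots> = (M' * (3 + A) powr \<kappa>) * Im s powr \<kappa>" using A s T0 by (simp add: powr_mult)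
    finally show ?thesis .
  qed
  then show ?thesis using that by blast
qed

lemma suminf_ln_eq_single:
  assumes "n > 0"
  shows "(\<Sum>k. if ln (real n) - ln (real (Suc k)) = 0 then f k else (0::complex)) = f (n - 1)"
proof -
  have "(ln (real n) - ln (real (Suc k)) = 0) \<longleftrightarrow> k = n - 1" for k
    using assms by auto
  then show ?thesis
    using sums_unique[OF sums_single[of "n - 1" f]] by simp
qed

text \<open>On Re s = 2 the mean of F s * n powr s picks out \<open>a n\<close> by absolute
  convergence. Moving the line to Re s = -A costs two horizontal segments: a fixed one at height
  \<open>T0\<close> and one at height T of size T powr \<kappa>, which vanishes after division by T.
  The factor n powr A is the normalisation of n powr s on the new line.\<close>

lemma coefficient_mean_value:
  assumes A: "A > 0" and \<kappa>: "0 \<le> \<kappa>" "\<kappa> < 1" and T0: "T0 \<ge> 1" and n: "n > 0"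
    and hol: "F holomorphic_on {s. Im s > 0}"
    and growth: "\<And>s. - A \<le> Re s \<Longrightarrow> Re s \<le> 2 \<Longrightarrow> Im s \<ge> 1 \<Longrightarrow> norm (F s) \<le> C * exp (norm s ^ p)"
    and left: "\<And>t. t \<ge> T0 \<Longrightarrow> norm (F (Complex (- A) t)) \<le> M * t powr \<kappa>"
    and dir: "\<And>t. dirichlet_sums a (Complex 2 t) (F (Complex 2 t))"
    and sum: "summable (\<lambda>n. norm (a (Suc n)) * real (Suc n) powr (- 2))"
  shows "((\<lambda>T. integral {T0..T} (\<lambda>t. F (Complex (- A) t) * cis (ln (real n) * t)) / of_real T)
           \<longlongrightarrow> a n * of_real (real n powr A)) at_top"
proof -
  define c where "c = (\<lambda>k. a (Suc k) * of_real (real (Suc k) powr (- 2)))"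
  have sc: "summable (\<lambda>k. norm (c k))" using sum by (simp add: c_def norm_mult)
  have F2: "(\<lambda>k. c k * cis (- ln (real (Suc k)) * t)) sums F (Complex 2 t)" for t
    using dir[of t] unfolding dirichlet_sums_Complex c_def .
  have "norm (F (Complex 2 t)) \<le> (\<Sum>k. norm (c k))" for t
    unfolding sums_unique[OF F2[of t]] by (rule norm_suminf_le[OF _ sc]) (simp add: norm_mult)
  then have right: "norm (F (Complex 2 t)) \<le> max M (\<Sum>k. norm (c k))" for t by (simp add: le_max_iff_disj)
  have left': "norm (F (Complex (- A) t)) \<le> max M (\<Sum>k. norm (c k)) * t powr \<kappa>" if "t \<ge> T0" for t
    by (rule order_trans[OF left[OF that] mult_right_mono]) auto
  obtain B where B: "\<And>s. - A \<le> Re s \<Longrightarrow> Re s \<le> 2 \<Longrightarrow> Im s \<ge> T0 \<Longrightarrow> norm (F s) \<le> B * Im s powr \<kappa>"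
    using polynomial_growth_half_strip[OF A \<kappa>(1) T0 hol growth left' right] by blast
  define g where "g = (\<lambda>s. F s * exp (of_real (ln (real n)) * s))"
  have g_line: "g (Complex \<sigma> t) = of_real (real n powr \<sigma>) * (F (Complex \<sigma> t) * cis (ln (real n) * t))" for \<sigma> t
    using n unfolding g_def exp_eq_polar by (simp add: powr_def)
  have oH: "open {s. Im s > 0}" by (rule open_halfspace_Im_gt)
  obtain P where "\<And>s. s \<in> {s. Im s > 0} \<Longrightarrow> (P has_field_derivative g s) (at s within {s. Im s > 0})"
  proof (rule holomorphic_convex_primitive'[of "{s. Im s > 0}" g])
    show "g holomorphic_on {s. Im s > 0}" unfolding g_def by (intro holomorphic_intros hol)
  qed (auto simp: oH convex_halfspace_Im_gt)
  then have P: "(P has_field_derivative g s) (at s)" if "Im s > 0" for s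
    using at_within_open[OF _ oH] that by fastforce
  define K where "K = norm (P (Complex 2 T0) - P (Complex (- A) T0))"
  define L where "L = (\<lambda>T. integral {T0..T} (\<lambda>t. g (Complex (- A) t)))"
  define R where "R = (\<lambda>T. integral {T0..T} (\<lambda>t. g (Complex 2 t)))"
  \<comment> \<open>\<open>P\<close> has derivative \<open>g\<close>, so its increment along the
    segment at height T is at most the length 2 + A times the maximum of \<open>g\<close>;
    \<open>K\<close> is the increment at height \<open>T0\<close>.\<close>
  have diff: "norm (R T - L T) \<le> (B * real n powr 2 * (2 + A)) * T powr \<kappa> + K" if T: "T \<ge> T0" for T
  proof -
    have "norm (P (Complex 2 T) - P (Complex (- A) T)) \<le> (B * T powr \<kappa> * real n powr 2) * norm (Complex 2 T - Complex (- A) T)"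
    proof (rule field_differentiable_bound)
      show "convex (closed_segment (Complex (- A) T) (Complex 2 T))" by simp
      fix z assume z: "z \<in> closed_segment (Complex (- A) T) (Complex 2 T)"
      have z': "Im z = T" "- A \<le> Re z" "Re z \<le> 2"
      proof -
        obtain u where u: "0 \<le> u" "u \<le> 1" "z = (1 - u) *\<^sub>R Complex (- A) T + u *\<^sub>R Complex 2 T"
          using z by (auto simp: in_segment)
        have zc: "z = Complex (- A + u * (2 + A)) T"
          unfolding u(3) by (simp add: complex_eq_iff algebra_simps)
        have "u * (2 + A) \<le> 1 * (2 + A)" "u * (2 + A) \<ge> 0"
          using u(1,2) A by (intro mult_right_mono mult_nonneg_nonneg; simp)+
        then show "- A \<le> Re z" "Re z \<le> 2" "Im z = T" unfolding zc by simp_all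
      qed
      show "(P has_field_derivative g z) (at z within closed_segment (Complex (- A) T) (Complex 2 T))"
        using P[of z] z' T T0 by (auto intro: has_field_derivative_at_within)
      have "norm (g z) = norm (F z) * real n powr Re z"
        using g_line[of "Re z" "Im z"] by (simp add: norm_mult)
      also have "\<dots> \<le> (B * T powr \<kappa>) * real n powr 2"
        using B[of z] z' T n by (intro mult_mono powr_mono) (auto intro: order_trans[OF norm_ge_zero])
      finally show "norm (g z) \<le> B * T powr \<kappa> * real n powr 2" .
    qed auto
    also have "norm (Complex 2 T - Complex (- A) T) = 2 + A"
    proof -
      have "Complex 2 T - Complex (- A) T = of_real (2 + A)" by (simp add: complex_eq_iff)
      then show ?thesis using A by (simp only: norm_of_real)
    qed
    finally have 1: "norm (P (Complex 2 T) - P (Complex (- A) T)) \<le> (B * real n powr 2 * (2 + A)) * T powr \<kappa>"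
      by (simp add: mult_ac)
    have "\<i> * (R T - L T) = (P (Complex 2 T) - P (Complex (- A) T)) - (P (Complex 2 T0) - P (Complex (- A) T0))"
      using integral_vertical_segment[of P g T0 T, OF P] T T0
      unfolding R_def L_def right_diff_distrib by simp
    then have "norm (R T - L T) = norm ((P (Complex 2 T) - P (Complex (- A) T)) - (P (Complex 2 T0) - P (Complex (- A) T0)))"
      by (metis norm_mult norm_ii mult_1)
    also have "\<dots> \<le> norm (P (Complex 2 T) - P (Complex (- A) T)) + K"
      unfolding K_def by (rule norm_triangle_ineq4)
    finally show ?thesis using 1 by linarith
  qed
  have lim0: "((\<lambda>T. (R T - L T) / of_real T) \<longlongrightarrow> 0) at_top"
  proof (rule Lim_null_comparison)
    show "((\<lambda>T. ((B * real n powr 2 * (2 + A)) * T powr \<kappa> + K) / T) \<longlongrightarrow> 0) at_top"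
    proof -
      have "((\<lambda>T. X * T powr \<kappa> / T + K / T) \<longlongrightarrow> X * 0 + 0) at_top" for X
      proof (intro tendsto_add)
        have "((\<lambda>T. T powr (\<kappa> - 1)) \<longlongrightarrow> 0) at_top"
          using \<kappa> by (intro tendsto_neg_powr filterlim_ident) auto
        moreover have "\<forall>\<^sub>F T in at_top. T powr (\<kappa> - 1) = T powr \<kappa> / T"
          using eventually_gt_at_top[of 0] by eventually_elim (simp add: powr_diff)
        ultimately have "((\<lambda>T. T powr \<kappa> / T) \<longlongrightarrow> 0) at_top" by (rule Lim_transform_eventually)
        then show "((\<lambda>T. X * T powr \<kappa> / T) \<longlongrightarrow> X * 0) at_top"
          unfolding times_divide_eq_right[symmetric] by (rule tendsto_mult_left)
        show "((\<lambda>T. K / T) \<longlongrightarrow> 0) at_top" by real_asymp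
      qed
      then show ?thesis by (simp add: add_divide_distrib)
    qed
    show "\<forall>\<^sub>F T in at_top. norm ((R T - L T) / of_real T) \<le> ((B * real n powr 2 * (2 + A)) * T powr \<kappa> + K) / T"
      using eventually_ge_at_top[of T0]
    proof eventually_elim
      case (elim T)
      then show ?case using diff[OF elim] T0 by (simp add: norm_divide divide_right_mono)
    qed
  qed
  have limR: "((\<lambda>T. R T / of_real T) \<longlongrightarrow> a n) at_top"
  proof -
    have "g (Complex 2 t) = (\<Sum>k. (of_real (real n powr 2) * c k) * cis ((ln (real n) - ln (real (Suc k))) * t))" for t
    proof -
      have "(\<lambda>k. of_real (real n powr 2) * cis (ln (real n) * t) * (c k * cis (- ln (real (Suc k)) * t))) sums
          (of_real (real n powr 2) * cis (ln (real n) * t) * F (Complex 2 t))"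
        by (rule sums_mult[OF F2])
      moreover have "of_real (real n powr 2) * cis (ln (real n) * t) * (c k * cis (- ln (real (Suc k)) * t)) =
          (of_real (real n powr 2) * c k) * cis ((ln (real n) - ln (real (Suc k))) * t)" for k
      proof -
        have "cis ((ln (real n) - ln (real (Suc k))) * t) = cis (ln (real n) * t) * cis (- ln (real (Suc k)) * t)"
          by (simp add: cis_mult algebra_simps)
        then show ?thesis by (simp add: mult_ac)
      qed
      moreover have "g (Complex 2 t) = of_real (real n powr 2) * cis (ln (real n) * t) * F (Complex 2 t)"
        unfolding g_line by (simp add: mult_ac)
      ultimately have "(\<lambda>k. (of_real (real n powr 2) * c k) * cis ((ln (real n) - ln (real (Suc k))) * t)) sums g (Complex 2 t)"
        by (simp only:)
      then show ?thesis by (rule sums_unique)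
    qed
    then have "R = (\<lambda>T. integral {T0..T} (\<lambda>t. \<Sum>k. (of_real (real n powr 2) * c k) * cis ((ln (real n) - ln (real (Suc k))) * t)))"
      by (simp add: R_def)
    moreover have "summable (\<lambda>k. norm (of_real (real n powr 2) * c k))"
      unfolding norm_mult by (rule summable_mult[OF sc])
    ultimately have "((\<lambda>T. R T / of_real T) \<longlongrightarrow> of_real (real n powr 2) * c (n - 1)) at_top"
      using mean_value_exponential_series[of "\<lambda>k. of_real (real n powr 2) * c k" T0 "\<lambda>k. ln (real n) - ln (real (Suc k))"]
      unfolding suminf_ln_eq_single[OF n] by simp
    moreover have "of_real (real n powr 2) * c (n - 1) = a n"
    proof -
      have "real n powr 2 * real n powr (- 2) = 1" using n unfolding powr_add[symmetric] by simp
      then have "complex_of_real (real n powr 2) * of_real (real n powr (- 2)) = 1"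
        by (metis of_real_1 of_real_mult)
      then show ?thesis using n by (simp add: c_def mult.left_commute)
    qed
    ultimately show ?thesis by simp
  qed
  have "((\<lambda>T. R T / of_real T - (R T - L T) / of_real T) \<longlongrightarrow> a n - 0) at_top"
    by (intro tendsto_diff limR lim0)
  then have "((\<lambda>T. L T / of_real T) \<longlongrightarrow> a n) at_top" by (simp add: diff_divide_distrib)
  then have "((\<lambda>T. L T / of_real T * of_real (real n powr A)) \<longlongrightarrow> a n * of_real (real n powr A)) at_top"
    by (rule tendsto_mult_right)
  moreover have "L T / of_real T * of_real (real n powr A) =
     integral {T0..T} (\<lambda>t. F (Complex (- A) t) * cis (ln (real n) * t)) / of_real T" for T
  proof -
    have "complex_of_real (real n powr (- A)) * of_real (real n powr A) = of_real (real n powr (- A) * real n powr A)" by simp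
    also have "real n powr (- A) * real n powr A = 1" using n unfolding powr_add[symmetric] by simp
    finally have e: "complex_of_real (real n powr (- A)) * of_real (real n powr A) = 1" by simp
    have "L T = of_real (real n powr (- A)) * integral {T0..T} (\<lambda>t. F (Complex (- A) t) * cis (ln (real n) * t))"
      unfolding L_def g_line by simp
    then have "L T * of_real (real n powr A) = complex_of_real (real n powr (- A)) * of_real (real n powr A) *
        integral {T0..T} (\<lambda>t. F (Complex (- A) t) * cis (ln (real n) * t))"
      by (simp only: mult_ac)
    then show ?thesis unfolding e by simp
  qed
  ultimately show ?thesis by (simp only:)
qed

section \<open>Consequences of the functional equation\<close>

text \<open>This turns the functional equation, stated off a set without limit points, into an
  equality at every point where both sides are continuous.\<close>

lemma eventually_cosparse_UNIV_eq_imp_eq: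
  fixes f g :: "complex \<Rightarrow> complex"
  assumes "eventually (\<lambda>s. f s = g s) (cosparse UNIV)" "isCont f z" "isCont g z"
  shows "f z = g z"
proof -
  have "eventually (\<lambda>s. f s = g s) (at z)"
    using assms(1) by (rule eventually_cosparse_imp_eventually_at) simp
  then have "(g \<longlongrightarrow> f z) (at z)"
    using assms(2) Lim_transform_eventually unfolding isCont_def by blast
  then show ?thesis
    using assms(3) LIM_unique unfolding isCont_def by blast
qed

text \<open>An integer exponent and a bound without an exceptional compact set are what the
  half-strip argument takes. The condition norm s \<ge> 1 allows the exponent to be rounded
  up.\<close>

lemma finite_order_imp_bound:
  assumes "G holomorphic_on UNIV" "finite_order G"
  obtains C :: real and p :: nat where "\<And>s. norm s \<ge> 1 \<Longrightarrow> norm (G s) \<le> C * exp (norm s ^ p)"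
proof -
  obtain \<rho> :: real where "(\<lambda>s. norm (G s)) \<in> O[at_infinity](\<lambda>s. exp (norm s powr \<rho>))"
    using assms(2) unfolding finite_order_def by blast
  then obtain c where "c > 0" "\<forall>\<^sub>F s in at_infinity. norm (norm (G s)) \<le> c * norm (exp (norm s powr \<rho>))"
    by (rule landau_o.bigE)
  then have c: "c > 0" "\<forall>\<^sub>F s in at_infinity. norm (G s) \<le> c * exp (norm s powr \<rho>)"
    by simp_all
  then obtain b where b: "\<And>s. norm s \<ge> b \<Longrightarrow> norm (G s) \<le> c * exp (norm s powr \<rho>)"
    unfolding eventually_at_infinity by blast
  have "continuous_on (cball 0 b) G"
    using holomorphic_on_imp_continuous_on[OF assms(1)] continuous_on_subset by blast
  then have "bounded (G ` cball 0 b)"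
    by (intro compact_imp_bounded compact_continuous_image) auto
  then obtain M where M: "\<And>s. norm s \<le> b \<Longrightarrow> norm (G s) \<le> M"
    unfolding bounded_iff by (metis imageI mem_cball_0)
  define p where "p = nat \<lceil>\<rho>\<rceil>"
  have "norm (G s) \<le> max c M * exp (norm s ^ p)" if s: "norm s \<ge> 1" for s
  proof (cases "norm s \<le> b")
    case True
    have "norm (G s) \<le> max c M * 1" using M[OF True] by simp
    also have "\<dots> \<le> max c M * exp (norm s ^ p)" using c(1) by (intro mult_left_mono) auto
    finally show ?thesis .
  next
    case False
    have "\<rho> \<le> real p" by (simp add: p_def) linarith
    then have "norm s powr \<rho> \<le> norm s powr real p" using s by (intro powr_mono) auto
    also have "\<dots> = norm s ^ p" using s by (intro powr_realpow) linarith
    finally have "c * exp (norm s powr \<rho>) \<le> max c M * exp (norm s ^ p)"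
      using c(1) by (intro mult_mono) auto
    then show ?thesis using b[of s] False by simp
  qed
  then show ?thesis using that by blast
qed

lemma isCont_gamma_factor:
  assumes "Q > 0" "\<And>i. i < k \<Longrightarrow> Im (of_real (w i) * s + \<mu> i) > 0"
  shows "isCont (gamma_factor \<epsilon> Q k w \<mu>) s"
proof -
  have "isCont (\<lambda>s. of_real Q powr s) s"
    using assms(1) by (intro continuous_intros) auto
  moreover have "isCont (\<lambda>s. \<Prod>i<k. Gamma (of_real (w i) * s + \<mu> i)) s"
  proof (intro continuous_prod)
    fix i assume "i \<in> {..<k}"
    then have "of_real (w i) * s + \<mu> i \<notin> \<int>\<^sub>\<le>\<^sub>0" using assms(2)[of i] by (intro Im_pos_notin_nonpos_Ints) auto
    then show "isCont (\<lambda>s. Gamma (of_real (w i) * s + \<mu> i)) s"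
      by (intro continuous_intros)
  qed
  ultimately show ?thesis
    unfolding gamma_factor_def by (intro continuous_mult continuous_const)
qed

text \<open>s and 1 - cnj s have the same imaginary part, so the one condition \<tau> keeps the
  Gamma factors on both sides away from their poles.\<close>

lemma functional_equation_reflected:
  assumes fe: "functional_equation F \<epsilon> Q k w \<mu>" and hol: "F holomorphic_on - {1}"
    and s: "Im s > 0" and \<tau>: "\<And>i. i < k \<Longrightarrow> w i * Im s + Im (\<mu> i) > 0"
  shows "gamma_factor \<epsilon> Q k w \<mu> s * F s = cnj (gamma_factor \<epsilon> Q k w \<mu> (1 - cnj s) * F (1 - cnj s))"
proof -
  let ?g = "gamma_factor \<epsilon> Q k w \<mu>"
  have Q: "Q > 0" using fe by (simp add: functional_equation_def)
  have F: "isCont F z" if "Im z > 0" for z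
    using continuous_on_eq_continuous_at[of "- {1}" F] holomorphic_on_imp_continuous_on[OF hol] that
    by (metis ComplI open_Compl closed_singleton less_irrefl one_complex.simps(2) singletonD)
  have cont: "isCont (\<lambda>s. ?g s * F s) z" if "Im z = Im s" for z
    using that \<tau> s by (intro continuous_mult isCont_gamma_factor Q F) auto
  have "isCont (\<lambda>s. cnj (?g (cnj (1 - s)) * F (cnj (1 - s)))) s"
  proof (rule isCont_cnj)
    have "isCont (\<lambda>z. (\<lambda>s. ?g s * F s) (cnj (1 - z))) s"
      by (rule isCont_o2[where f = "\<lambda>z. cnj (1 - z)" and g = "\<lambda>s. ?g s * F s", OF _ cont]) (auto intro!: continuous_intros)
    then show "isCont (\<lambda>s. ?g (cnj (1 - s)) * F (cnj (1 - s))) s" by simp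
  qed
  moreover have "\<forall>\<^sub>\<approx>s\<in>UNIV. ?g s * F s = cnj (?g (cnj (1 - s)) * F (cnj (1 - s)))"
    using fe unfolding functional_equation_def conj_fun_def Let_def by blast
  ultimately have "?g s * F s = cnj (?g (cnj (1 - s)) * F (cnj (1 - s)))"
    using cont[of s] by (intro eventually_cosparse_UNIV_eq_imp_eq[where f = "\<lambda>s. ?g s * F s"]) auto
  then show ?thesis by simp
qed

text \<open>Since norm \<epsilon> = 1, dividing by \<epsilon> is multiplying by its conjugate, and
  two such factors appear. \<open>A\<close> is an arbitrary real: a small positive one serves the
  shifted line, and -1/2 gives the critical line, which is reflected to itself.\<close>

lemma functional_equation_line:
  assumes fe: "functional_equation F \<epsilon> Q k w \<mu>" and hol: "F holomorphic_on - {1}"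
    and t: "t > 0" and \<tau>: "\<And>i. i < k \<Longrightarrow> w i * t + Im (\<mu> i) > 0"
  shows "F (Complex (- A) t) = (cnj \<epsilon>)\<^sup>2 * of_real (Q powr (1 + 2 * A)) * cis (- 2 * ln Q * t) *
           gamma_quotient A k w \<mu> t * cnj (F (Complex (1 + A) t))"
proof -
  have Q: "Q > 0" and e: "norm \<epsilon> = 1" using fe by (simp_all add: functional_equation_def)
  define P1 where "P1 = (\<Prod>i<k. Gamma (of_real (w i) * Complex (1 + A) t + \<mu> i))"
  define P2 where "P2 = (\<Prod>i<k. Gamma (of_real (w i) * Complex (- A) t + \<mu> i))"
  have P2: "P2 \<noteq> 0"
    unfolding P2_def using \<tau> by (auto simp: Gamma_eq_zero_iff intro!: Im_pos_notin_nonpos_Ints)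
  have gq: "gamma_quotient A k w \<mu> t = cnj P1 / P2"
    by (simp add: gamma_quotient_def P1_def P2_def prod_dividef)
  have "1 - cnj (Complex (- A) t) = Complex (1 + A) t" by (simp add: complex_eq_iff)
  then have eq: "\<epsilon> * (of_real (Q powr (- A)) * cis (ln Q * t)) * P2 * F (Complex (- A) t) =
      cnj (\<epsilon> * (of_real (Q powr (1 + A)) * cis (ln Q * t)) * P1 * F (Complex (1 + A) t))"
    using functional_equation_reflected[OF fe hol, of "Complex (- A) t"] t \<tau>
    by (simp add: gamma_factor_def of_real_powr_Complex[OF Q] P1_def P2_def)
  have ee: "cnj \<epsilon> * \<epsilon> = 1" using e complex_norm_square[of \<epsilon>] by (simp add: mult.commute)
  have cc: "cis (- ln Q * t) * cis (ln Q * t) = 1" by (simp add: cis_mult)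
  have qq: "complex_of_real (Q powr A) * of_real (Q powr (- A)) = 1"
    unfolding of_real_mult[symmetric] powr_add[symmetric] using Q by simp
  have "P2 * F (Complex (- A) t) = (cnj \<epsilon> * \<epsilon>) * (cis (- ln Q * t) * cis (ln Q * t)) *
      (complex_of_real (Q powr A) * of_real (Q powr (- A))) * P2 * F (Complex (- A) t)"
    unfolding ee cc qq by simp
  also have "\<dots> = cnj \<epsilon> * cis (- ln Q * t) * of_real (Q powr A) *
      (\<epsilon> * (of_real (Q powr (- A)) * cis (ln Q * t)) * P2 * F (Complex (- A) t))"
    by (simp only: mult_ac)
  also have "\<dots> = (cnj \<epsilon>)\<^sup>2 * (of_real (Q powr A) * of_real (Q powr (1 + A))) *
      (cis (- ln Q * t) * cnj (cis (ln Q * t))) * cnj P1 * cnj (F (Complex (1 + A) t))"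
    unfolding eq by (simp add: power2_eq_square mult_ac)
  also have "complex_of_real (Q powr A) * of_real (Q powr (1 + A)) = of_real (Q powr (1 + 2 * A))"
    unfolding of_real_mult[symmetric] powr_add[symmetric] by (simp add: algebra_simps)
  also have "cis (- ln Q * t) * cnj (cis (ln Q * t)) = cis (- 2 * ln Q * t)"
    by (simp add: cis_cnj cis_mult algebra_simps)
  finally show ?thesis using P2 by (simp add: gq field_simps)
qed

text \<open>Conjugation reverses the frequencies of the series on Re s = 1 + A, so n oscillates with
  ln n - 2 * ln Q; the Gamma quotient is common to all terms.\<close>

lemma functional_equation_series:
  fixes a :: "nat \<Rightarrow> complex"
  assumes fe: "functional_equation F \<epsilon> Q k w \<mu>" and hol: "F holomorphic_on - {1}"
    and t: "t > 0" and \<tau>: "\<And>i. i < k \<Longrightarrow> w i * t + Im (\<mu> i) > 0"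
    and dir: "dirichlet_sums a (Complex (1 + A) t) (F (Complex (1 + A) t))"
  shows "(\<lambda>n. (cnj \<epsilon>)\<^sup>2 * of_real (Q powr (1 + 2 * A)) * cnj (a (Suc n)) * of_real (real (Suc n) powr (- (1 + A))) *
            (gamma_quotient A k w \<mu> t * cis ((ln (real (Suc n)) - 2 * ln Q) * t))) sums F (Complex (- A) t)"
proof -
  have "(\<lambda>n. cnj (a (Suc n) * of_real (real (Suc n) powr (- (1 + A))) * cis (- ln (real (Suc n)) * t))) sums cnj (F (Complex (1 + A) t))"
    using dir unfolding dirichlet_sums_Complex by (simp only: sums_cnj)
  from sums_mult[OF this, of "(cnj \<epsilon>)\<^sup>2 * of_real (Q powr (1 + 2 * A)) * cis (- 2 * ln Q * t) * gamma_quotient A k w \<mu> t"]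
  have "(\<lambda>n. (cnj \<epsilon>)\<^sup>2 * of_real (Q powr (1 + 2 * A)) * cis (- 2 * ln Q * t) * gamma_quotient A k w \<mu> t *
      cnj (a (Suc n) * of_real (real (Suc n) powr (- (1 + A))) * cis (- ln (real (Suc n)) * t))) sums F (Complex (- A) t)"
    using functional_equation_line[OF fe hol t \<tau>, of A] by (simp only:)
  moreover have "(cnj \<epsilon>)\<^sup>2 * of_real (Q powr (1 + 2 * A)) * cis (- 2 * ln Q * t) * gamma_quotient A k w \<mu> t *
      cnj (a (Suc n) * of_real (real (Suc n) powr (- (1 + A))) * cis (- ln (real (Suc n)) * t)) =
      (cnj \<epsilon>)\<^sup>2 * of_real (Q powr (1 + 2 * A)) * cnj (a (Suc n)) * of_real (real (Suc n) powr (- (1 + A))) *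
            (gamma_quotient A k w \<mu> t * cis ((ln (real (Suc n)) - 2 * ln Q) * t))" for n
  proof -
    have "cis ((ln (real (Suc n)) - 2 * ln Q) * t) = cis (- 2 * ln Q * t) * cnj (cis (- ln (real (Suc n)) * t))"
      by (simp add: cis_cnj cis_mult algebra_simps)
    then show ?thesis by (simp only: complex_cnj_mult complex_cnj_complex_of_real mult_ac)
  qed
  ultimately show ?thesis by (simp only:)
qed

text \<open>One mean value over Re s = -A is computed in two ways. As a coefficient of the series it
  is a n * n powr A; through the functional equation it is 0 if k > 0, and for k = 0 it can be
  nonzero only if some frequency ln m + ln n - 2 * ln Q vanishes.\<close>

lemma degree_less_one_coefficients:
  fixes a :: "nat \<Rightarrow> complex"
  assumes fe: "functional_equation F \<epsilon> Q k w \<mu>" and d: "2 * (\<Sum>i<k. w i) < 1"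
    and hol: "F holomorphic_on - {1}"
    and growth: "\<And>s. Im s \<ge> 1 \<Longrightarrow> norm (F s) \<le> C * exp (norm s ^ p)"
    and dir: "\<And>s. Re s > 1 \<Longrightarrow> dirichlet_sums a s (F s)"
    and ram: "\<And>\<epsilon>::real. \<epsilon> > 0 \<Longrightarrow> (\<lambda>n. norm (a n)) \<in> O(\<lambda>n. real n powr \<epsilon>)"
    and a1: "a 1 = 1"
  shows "k = 0 \<and> (\<forall>n>0. a n \<noteq> 0 \<longrightarrow> (\<exists>m>0. real (m * n) = Q\<^sup>2))"
proof -
  define d where "d = 2 * (\<Sum>i<k. w i)"
  have Q: "Q > 0" and e: "norm \<epsilon> = 1" and w: "\<And>i. i < k \<Longrightarrow> w i > 0 \<and> Re (\<mu> i) \<ge> 0"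
    using fe by (simp_all add: functional_equation_def)
  have d01: "0 \<le> d" "d < 1"
    using assms(2) w sum_nonneg[of "{..<k}" w] by (auto simp: d_def less_imp_le)
  define A where "A = (1 - d) / 4"
  define \<kappa> where "\<kappa> = (1 + d) / 4"
  have A: "0 < A" "A \<le> 1" using d01 by (auto simp: A_def)
  have \<kappa>: "0 \<le> \<kappa>" "\<kappa> < 1 / 2" using d01 by (auto simp: \<kappa>_def)
  have wA: "w i * A \<le> 1" if i: "i < k" for i
  proof -
    have "w i \<le> (\<Sum>i<k. w i)" using i w by (intro member_le_sum) (auto intro: less_imp_le)
    then have "w i \<le> 1" using d01 by (simp add: d_def)
    then show ?thesis using mult_mono[of "w i" 1 A 1] A by simp
  qed
  have sl: "(\<Sum>i<k. w i) * (1 + 2 * A) < \<kappa>"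
  proof -
    have "(1 - d) * (1 - d) > 0" using d01 by simp
    moreover have "\<kappa> - d / 2 * (1 + 2 * A) = (1 - d) * (1 - d) / 4" by (simp add: A_def \<kappa>_def field_simps)
    ultimately have "d / 2 * (1 + 2 * A) < \<kappa>" by simp
    then show ?thesis by (simp add: d_def)
  qed
  obtain T0 B where T0: "T0 \<ge> 1" and B: "B > 0"
    and tau: "\<And>i t. i < k \<Longrightarrow> t \<ge> T0 \<Longrightarrow> w i * t + Im (\<mu> i) \<ge> 1"
    and contR: "continuous_on {T0..} (gamma_quotient A k w \<mu>)"
    and R_le: "\<And>t. t \<ge> T0 \<Longrightarrow> norm (gamma_quotient A k w \<mu> t) \<le> B * t powr \<kappa>"
    and int: "\<And>x T. k > 0 \<Longrightarrow> T \<ge> T0 \<Longrightarrow>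
        norm (integral {T0..T} (\<lambda>t. gamma_quotient A k w \<mu> t * cis (x * t))) \<le> B * T powr (\<kappa> + 1/2)"
    by (rule gamma_quotient_estimates[of k w A \<mu> \<kappa>]) (use w wA A sl in auto)
  let ?R = "gamma_quotient A k w \<mu>"
  define c where "c = (\<lambda>n. (cnj \<epsilon>)\<^sup>2 * of_real (Q powr (1 + 2 * A)) * cnj (a (Suc n)) * of_real (real (Suc n) powr (- (1 + A))))"
  define l where "l = (\<lambda>n. ln (real (Suc n)) - 2 * ln Q)"
  \<comment> \<open>With the exponent A / 2 in the Ramanujan bound, 1 + A still lies in the
    half-plane of absolute convergence.\<close>
  have sc: "summable (\<lambda>n. norm (c n))"
  proof -
    have "summable (\<lambda>n. norm (a (Suc n)) * real (Suc n) powr (- (1 + A)))"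
      by (rule summable_dirichlet_bigo[OF ram[of "A / 2"]]) (use A in auto)
    then have "summable (\<lambda>n. Q powr (1 + 2 * A) * (norm (a (Suc n)) * real (Suc n) powr (- (1 + A))))"
      by (rule summable_mult)
    then show ?thesis using e by (simp add: c_def norm_mult norm_power mult.assoc del: of_nat_Suc)
  qed
  have series: "(\<lambda>n. c n * (?R t * cis (l n * t))) sums F (Complex (- A) t)" if t: "t \<ge> T0" for t
    unfolding c_def l_def
    by (rule functional_equation_series[OF fe hol]) (use t T0 tau[of _ t] dir A in \<open>force+\<close>)
  have F_le: "norm (F (Complex (- A) t)) \<le> (B * (\<Sum>n. norm (c n))) * t powr \<kappa>" if t: "t \<ge> T0" for t
  proof -
    have "norm (F (Complex (- A) t)) \<le> (\<Sum>n. norm (c n) * norm (?R t))"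
      unfolding sums_unique[OF series[OF t]]
      by (rule norm_suminf_le[OF _ summable_mult2[OF sc]]) (simp add: norm_mult)
    also have "\<dots> = (\<Sum>n. norm (c n)) * norm (?R t)" by (rule suminf_mult2[OF sc, symmetric])
    also have "\<dots> \<le> (\<Sum>n. norm (c n)) * (B * t powr \<kappa>)"
      by (intro mult_left_mono R_le t suminf_nonneg sc) auto
    finally show ?thesis by (simp add: mult_ac)
  qed
  have mean: "((\<lambda>T. integral {T0..T} (\<lambda>t. F (Complex (- A) t) * cis (ln (real n) * t)) / of_real T)
           \<longlongrightarrow> a n * of_real (real n powr A)) at_top" if n: "n > 0" for n
  proof (rule coefficient_mean_value[OF A(1) \<kappa>(1) _ T0 n _ _ F_le])
    show "\<kappa> < 1" using \<kappa> by simp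
    show "F holomorphic_on {s. Im s > 0}" by (rule holomorphic_on_subset[OF hol]) auto
    show "norm (F s) \<le> C * exp (norm s ^ p)" if "Im s \<ge> 1" for s by (rule growth[OF that])
    show "dirichlet_sums a (Complex 2 t) (F (Complex 2 t))" for t by (rule dir) simp
    show "summable (\<lambda>n. norm (a (Suc n)) * real (Suc n) powr (- 2))"
      by (rule summable_dirichlet_bigo[OF ram[of "1 / 2"]]) auto
  qed
  have integrand: "F (Complex (- A) t) * cis (ln (real n) * t) = ?R t * (\<Sum>j. c j * cis ((l j + ln (real n)) * t))"
    if "t \<ge> T0" for t n
  proof -
    have "(\<lambda>j. c j * (?R t * cis (l j * t)) * cis (ln (real n) * t)) sums (F (Complex (- A) t) * cis (ln (real n) * t))"
      by (rule sums_mult2[OF series[OF that]])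
    moreover have "c j * (?R t * cis (l j * t)) * cis (ln (real n) * t) = ?R t * (c j * cis ((l j + ln (real n)) * t))" for j
    proof -
      have "cis ((l j + ln (real n)) * t) = cis (l j * t) * cis (ln (real n) * t)"
        by (simp add: cis_mult distrib_right)
      then show ?thesis by (simp only: mult_ac)
    qed
    ultimately have "(\<lambda>j. ?R t * (c j * cis ((l j + ln (real n)) * t))) sums (F (Complex (- A) t) * cis (ln (real n) * t))"
      by (simp only:)
    from sums_unique[OF this]
    have "F (Complex (- A) t) * cis (ln (real n) * t) = (\<Sum>j. ?R t * (c j * cis ((l j + ln (real n)) * t)))" .
    also have "summable (\<lambda>j. c j * cis ((l j + ln (real n)) * t))"
      by (rule summable_norm_cancel) (simp add: norm_mult sc)
    note suminf_mult[OF this]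
    finally show ?thesis .
  qed
  have k0: "k = 0"
  proof (rule ccontr)
    assume "k \<noteq> 0"
    then have k: "k > 0" by simp
    have "((\<lambda>T. integral {T0..T} (\<lambda>t. F (Complex (- A) t) * cis (ln (real 1) * t)) / of_real T) \<longlongrightarrow> 0) at_top"
    proof (rule Lim_null_comparison)
      show "\<forall>\<^sub>F T in at_top. norm (integral {T0..T} (\<lambda>t. F (Complex (- A) t) * cis (ln (real 1) * t)) / of_real T)
         \<le> (\<Sum>n. norm (c n)) * B * T powr (\<kappa> - 1/2)"
        using eventually_ge_at_top[of T0]
      proof eventually_elim
        case (elim T)
        have T: "T > 0" using elim T0 by simp
        have "(\<lambda>j. c j * integral {T0..T} (\<lambda>t. ?R t * cis ((l j + ln (real 1)) * t))) sums
            integral {T0..T} (\<lambda>t. ?R t * (\<Sum>j. c j * cis ((l j + ln (real 1)) * t)))"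
          by (rule integral_exponential_series[OF sc continuous_on_subset[OF contR]]) auto
        also have "integral {T0..T} (\<lambda>t. ?R t * (\<Sum>j. c j * cis ((l j + ln (real 1)) * t))) =
            integral {T0..T} (\<lambda>t. F (Complex (- A) t) * cis (ln (real 1) * t))"
          by (rule integral_cong) (simp only: integrand atLeastAtMost_iff)
        finally have s: "(\<lambda>j. c j * integral {T0..T} (\<lambda>t. ?R t * cis ((l j + ln (real 1)) * t))) sums
            integral {T0..T} (\<lambda>t. F (Complex (- A) t) * cis (ln (real 1) * t))" .
        have "norm (integral {T0..T} (\<lambda>t. F (Complex (- A) t) * cis (ln (real 1) * t))) \<le>
            (\<Sum>j. norm (c j) * (B * T powr (\<kappa> + 1/2)))"
          unfolding sums_unique[OF s]
          by (rule norm_suminf_le[OF _ summable_mult2[OF sc]])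
             (unfold norm_mult, intro mult_left_mono int k elim norm_ge_zero)
        also have "\<dots> = (\<Sum>n. norm (c n)) * B * T powr (\<kappa> + 1/2)"
          using suminf_mult2[OF sc, of "B * T powr (\<kappa> + 1/2)"] by (simp only: mult.assoc)
        also have "T powr (\<kappa> + 1/2) = T powr (\<kappa> - 1/2) * T"
        proof -
          have e: "\<kappa> + 1/2 = (\<kappa> - 1/2) + 1" by simp
          show ?thesis unfolding e powr_add using T by simp
        qed
        finally show ?case using T by (simp add: norm_divide pos_divide_le_eq mult.assoc)
      qed
      have "((\<lambda>T. T powr (\<kappa> - 1/2)) \<longlongrightarrow> 0) at_top"
        using \<kappa> by (intro tendsto_neg_powr filterlim_ident) auto
      then show "((\<lambda>T. (\<Sum>n. norm (c n)) * B * T powr (\<kappa> - 1/2)) \<longlongrightarrow> 0) at_top"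
        by (rule tendsto_mult_right_zero)
    qed
    then have "a 1 * of_real (real 1 powr A) = 0"
      using mean[of 1] by (intro tendsto_unique[OF trivial_limit_at_top_linorder]) auto
    then show False using a1 by simp
  qed
  moreover have "\<exists>m>0. real (m * n) = Q\<^sup>2" if n: "n > 0" "a n \<noteq> 0" for n
  proof (rule ccontr)
    assume neg: "\<not> ?thesis"
    have R1: "?R t = 1" for t using k0 by (simp add: gamma_quotient_def)
    have "l j + ln (real n) \<noteq> 0" for j
    proof
      assume "l j + ln (real n) = 0"
      then have "ln (real (Suc j)) + ln (real n) = 2 * ln Q" by (simp add: l_def)
      moreover have "ln (real (Suc j * n)) = ln (real (Suc j)) + ln (real n)"
        unfolding of_nat_mult using n by (simp add: ln_mult del: of_nat_Suc)
      ultimately have "ln (real (Suc j * n)) = ln (Q\<^sup>2)"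
        using Q by (simp only: ln_realpow of_nat_numeral)
      moreover have "real (Suc j * n) > 0" using n by (simp only: of_nat_0_less_iff) simp
      ultimately have "real (Suc j * n) = Q\<^sup>2" using Q ln_inj_iff[of "real (Suc j * n)" "Q\<^sup>2"] by simp
      then show False using neg by blast
    qed
    then have "((\<lambda>T. integral {T0..T} (\<lambda>t. \<Sum>j. c j * cis ((l j + ln (real n)) * t)) / of_real T) \<longlongrightarrow> 0) at_top"
      using mean_value_exponential_series[OF sc, of T0 "\<lambda>j. l j + ln (real n)"] by simp
    moreover have "integral {T0..T} (\<lambda>t. \<Sum>j. c j * cis ((l j + ln (real n)) * t)) =
        integral {T0..T} (\<lambda>t. F (Complex (- A) t) * cis (ln (real n) * t))" for T
      by (rule integral_cong) (simp add: integrand R1)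
    ultimately have "((\<lambda>T. integral {T0..T} (\<lambda>t. F (Complex (- A) t) * cis (ln (real n) * t)) / of_real T) \<longlongrightarrow> 0) at_top"
      by simp
    then have "a n * of_real (real n powr A) = 0"
      using mean[OF n(1)] by (intro tendsto_unique[OF trivial_limit_at_top_linorder])
    then show False using n by simp
  qed
  ultimately show ?thesis by blast
qed

section \<open>Termwise differentiation and mean values of Dirichlet series\<close>

lemma has_field_derivative_of_nat_powr_minus:
  assumes "n > 0"
  shows "((\<lambda>s. (of_nat n :: complex) powr (- s)) has_field_derivative
           - of_real (ln (real n)) * of_nat n powr (- s)) (at s)"
proof -
  have "((\<lambda>s. (of_nat n :: complex) powr (- s)) has_field_derivative
      Ln (of_nat n) * of_nat n powr (- s) * (- 1)) (at s)"
    by (rule DERIV_chain2[OF has_field_derivative_powr_right])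
       (use assms in \<open>auto intro!: derivative_eq_intros\<close>)
  then show ?thesis using assms by (simp add: Ln_of_nat)
qed

text \<open>Used twice for the series of log F: with c = 2 before anything is known about its
  support, and with some c < 1/2 once the support is reduced to finitely many primes.\<close>

lemma dirichlet_series_derivative:
  fixes b :: "nat \<Rightarrow> complex"
  assumes "summable (\<lambda>n. norm (b (Suc n)) * real (Suc n) powr (- c))"
  shows "\<exists>g g'. \<forall>s. Re s > c \<longrightarrow> dirichlet_sums b s (g s) \<and>
    dirichlet_sums (\<lambda>n. - of_real (ln (real n)) * b n) s (g' s) \<and> (g has_field_derivative g' s) (at s)"
proof -
  let ?f = "\<lambda>n s. b (Suc n) * of_nat (Suc n) powr (- s)"
  let ?f' = "\<lambda>n s. - of_real (ln (real (Suc n))) * b (Suc n) * of_nat (Suc n) powr (- s)"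
  have le: "norm (?f n s) \<le> norm (b (Suc n)) * real (Suc n) powr (- c)" if "Re s > c" for n s
  proof -
    have "real (Suc n) powr (- Re s) \<le> real (Suc n) powr (- c)"
      using that by (intro powr_mono) auto
    moreover have "norm ((of_nat (Suc n) :: complex) powr (- s)) = real (Suc n) powr (- Re s)"
      by (subst norm_powr_real_powr) auto
    ultimately show ?thesis by (simp add: norm_mult mult_left_mono del: of_nat_Suc)
  qed
  have "\<exists>g g'. \<forall>s\<in>{s. Re s > c}. (\<lambda>n. ?f n s) sums g s \<and> (\<lambda>n. ?f' n s) sums g' s \<and> (g has_field_derivative g' s) (at s)"
  proof (rule series_and_derivative_comparison_complex)
    show "open {s. Re s > c}" by (rule open_halfspace_Re_gt)
    show "(?f n has_field_derivative ?f' n s) (at s)" for n s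
      using DERIV_cmult[OF has_field_derivative_of_nat_powr_minus[of "Suc n"], of "b (Suc n)"]
      by (simp only: mult_ac zero_less_Suc)

    fix s assume "s \<in> {s. Re s > c}"
    show "\<exists>d h. 0 < d \<and> summable (h :: nat \<Rightarrow> complex) \<and> range h \<subseteq> \<real>\<^sub>\<ge>\<^sub>0 \<and>
        (\<forall>\<^sub>F n in sequentially. \<forall>y\<in>ball s d \<inter> {s. Re s > c}. norm (?f n y) \<le> norm (h n))"
    proof -
      let ?h = "\<lambda>n. complex_of_real (norm (b (Suc n)) * real (Suc n) powr (- c))"
      have h: "norm (?h n) = norm (b (Suc n)) * real (Suc n) powr (- c)" for n
        unfolding norm_of_real by (simp add: abs_mult)
      have 1: "summable ?h" by (intro summable_of_real assms)
      have 2: "range ?h \<subseteq> \<real>\<^sub>\<ge>\<^sub>0" by (auto simp: nonneg_Reals_of_real_iff simp del: of_real_mult)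
      have 3: "\<forall>\<^sub>F n in sequentially. \<forall>y\<in>ball s 1 \<inter> {s. Re s > c}. norm (?f n y) \<le> norm (?h n)"
        unfolding h by (intro always_eventually allI ballI le) simp
      show ?thesis
        by (rule exI[of _ 1], rule exI[of _ ?h]) (intro conjI 1 2 3 zero_less_one)
    qed
  qed
  then show ?thesis unfolding dirichlet_sums_def by simp
qed

lemma continuous_on_exponential_series:
  fixes c :: "nat \<Rightarrow> complex"
  assumes "summable (\<lambda>k. norm (c k))"
  shows "continuous_on S (\<lambda>t. \<Sum>k. c k * cis (l k * t))"
proof (rule uniform_limit_theorem)
  show "uniform_limit S (\<lambda>n t. \<Sum>k<n. c k * cis (l k * t)) (\<lambda>t. \<Sum>k. c k * cis (l k * t)) sequentially"
    by (rule Weierstrass_m_test[OF _ assms]) (simp add: norm_mult)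
  show "\<forall>\<^sub>F n in sequentially. continuous_on S (\<lambda>t. \<Sum>k<n. c k * cis (l k * t))"
    by (intro always_eventually allI continuous_intros)
qed simp

lemma mean_value_sum:
  fixes f :: "'i \<Rightarrow> real \<Rightarrow> complex"
  assumes "\<And>d. d \<in> D \<Longrightarrow> continuous_on UNIV (f d)"
    and "\<And>d. d \<in> D \<Longrightarrow> ((\<lambda>T. integral {0..T} (f d) / of_real T) \<longlongrightarrow> m d) at_top" and "finite D"
  shows "((\<lambda>T. integral {0..T} (\<lambda>t. \<Sum>d\<in>D. f d t) / of_real T) \<longlongrightarrow> (\<Sum>d\<in>D. m d)) at_top"
proof -
  have "integral {0..T} (\<lambda>t. \<Sum>d\<in>D. f d t) / of_real T = (\<Sum>d\<in>D. integral {0..T} (f d) / of_real T)" for T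
    unfolding sum_divide_distrib[symmetric]
    by (subst integral_sum[OF assms(3)])
       (auto intro: integrable_continuous_real continuous_on_subset[OF assms(1)])
  then show ?thesis using assms(2) by (simp add: tendsto_sum)
qed

text \<open>The frequency is ln x for a real x since the product of a Dirichlet polynomial and a
  series leads to quotients N / d; only an integral quotient produces a coefficient.\<close>

lemma dirichlet_mean_value:
  fixes b :: "nat \<Rightarrow> complex" and x :: real
  assumes "summable (\<lambda>n. norm (b (Suc n)) * real (Suc n) powr (- \<sigma>))"
    and "\<And>t. dirichlet_sums b (Complex \<sigma> t) (g t)" "x > 0"
  shows "continuous_on UNIV (\<lambda>t. g t * cis (ln x * t))"
    "\<lbrakk>n > 0; real n = x\<rbrakk> \<Longrightarrow> ((\<lambda>T. integral {0..T} (\<lambda>t. g t * cis (ln x * t)) / of_real T)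
        \<longlongrightarrow> b n * of_real (x powr (- \<sigma>))) at_top"
    "(\<And>n. n > 0 \<Longrightarrow> real n \<noteq> x) \<Longrightarrow>
       ((\<lambda>T. integral {0..T} (\<lambda>t. g t * cis (ln x * t)) / of_real T) \<longlongrightarrow> 0) at_top"
proof -
  define c where "c = (\<lambda>k. b (Suc k) * of_real (real (Suc k) powr (- \<sigma>)))"
  have sc: "summable (\<lambda>k. norm (c k))" using assms(1) by (simp add: c_def norm_mult)
  define l where "l = (\<lambda>k. ln x - ln (real (Suc k)))"
  have "(\<lambda>k. c k * cis (l k * t)) sums (g t * cis (ln x * t))" for t
  proof -
    have "(\<lambda>k. c k * cis (- ln (real (Suc k)) * t) * cis (ln x * t)) sums (g t * cis (ln x * t))"
      using sums_mult2 assms(2)[of t] unfolding dirichlet_sums_Complex c_def by blast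
    moreover have "c k * cis (- ln (real (Suc k)) * t) * cis (ln x * t) = c k * cis (l k * t)" for k
      unfolding l_def mult.assoc cis_mult by (simp add: algebra_simps)
    ultimately show ?thesis by (simp only:)
  qed
  then have eq: "g t * cis (ln x * t) = (\<Sum>k. c k * cis (l k * t))" for t by (rule sums_unique)
  show "continuous_on UNIV (\<lambda>t. g t * cis (ln x * t))"
    unfolding eq by (rule continuous_on_exponential_series[OF sc])
  note mv = mean_value_exponential_series[OF sc, of 0 l]
  show "((\<lambda>T. integral {0..T} (\<lambda>t. g t * cis (ln x * t)) / of_real T)
        \<longlongrightarrow> b n * of_real (x powr (- \<sigma>))) at_top" if n: "n > 0" "real n = x"
    using mv suminf_ln_eq_single[OF n(1), of c] n by (simp add: eq l_def c_def)
  show "((\<lambda>T. integral {0..T} (\<lambda>t. g t * cis (ln x * t)) / of_real T) \<longlongrightarrow> 0) at_top"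
    if "\<And>n. n > 0 \<Longrightarrow> real n \<noteq> x"
  proof -
    have "l k \<noteq> 0" for k
      using that[of "Suc k"] assms(3) unfolding l_def by (simp del: of_nat_Suc)
    then show ?thesis using mv by (simp add: eq)
  qed
qed

section \<open>Degree zero and the Euler product\<close>

text \<open>The powers of one prime p give a geometric series of ratio p powr (\<theta> - \<delta>)
  < 1. With finitely many primes, absolute convergence thus starts right of \<theta>, and not only
  right of \<theta> + 1.\<close>

lemma summable_dirichlet_smooth_primepow:
  fixes b :: "nat \<Rightarrow> complex"
  assumes "(\<lambda>n. norm (b n)) \<in> O(\<lambda>n. real n powr \<theta>)" and "\<theta> < \<delta>" and "finite X"
    and "\<And>p. p \<in> X \<Longrightarrow> prime p" and "\<And>n. b n \<noteq> 0 \<Longrightarrow> \<exists>p\<in>X. \<exists>k. n = p ^ k"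
  shows "summable (\<lambda>n. norm (b (Suc n)) * real (Suc n) powr (- \<delta>))"
proof -
  obtain C where C: "C \<ge> 0" "\<And>n. n > 0 \<Longrightarrow> norm (b n) \<le> C * real n powr \<theta>"
    using bigo_powr_imp_bound[OF assms(1)] by blast
  define f where "f = (\<lambda>p n. if \<exists>k. n = p ^ k then real n powr (\<theta> - \<delta>) else 0)"
  have "summable (f p)" if p: "p \<in> X" for p :: nat
  proof -
    have p1: "p > 1" using assms(4)[OF p] prime_gt_1_nat by blast
    have "summable (\<lambda>k. f p (p ^ k))"
    proof -
      have "real p powr (\<theta> - \<delta>) < real p powr 0"
        using p1 assms(2) by (intro powr_less_mono) auto
      then have "real p powr (\<theta> - \<delta>) < 1" using p1 by simp
      then have "summable (\<lambda>k. (real p powr (\<theta> - \<delta>)) ^ k)"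
        by (intro summable_geometric) simp
      moreover have "f p (p ^ k) = (real p powr (\<theta> - \<delta>)) ^ k" for k
        using p1 by (auto simp: f_def powr_power powr_powr mult.commute simp flip: powr_realpow)
      ultimately show ?thesis by simp
    qed
    then show ?thesis
      by (subst (asm) summable_mono_reindex) (use p1 in \<open>auto simp: f_def strict_mono_def power_strict_increasing\<close>)
  qed
  then have "summable (\<lambda>n. C * (\<Sum>p\<in>X. f p n))" by (intro summable_mult summable_sum)
  then have "summable (\<lambda>n. norm (b n) * real n powr (- \<delta>))"
  proof (rule summable_comparison_test'[where N = 1])
    fix n :: nat assume n: "n \<ge> 1"
    have f0: "f p n \<ge> 0" for p by (simp add: f_def)
    show "norm (norm (b n) * real n powr (- \<delta>)) \<le> C * (\<Sum>p\<in>X. f p n)"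
    proof (cases "b n = 0")
      case True
      then show ?thesis using C(1) f0 by (simp add: sum_nonneg)
    next
      case False
      then obtain p k where pk: "p \<in> X" "n = p ^ k" using assms(5) by blast
      have "norm (b n) * real n powr (- \<delta>) \<le> C * real n powr \<theta> * real n powr (- \<delta>)"
        using C(2) n by (intro mult_right_mono) auto
      also have "\<dots> = C * f p n" using pk by (auto simp: f_def mult.assoc powr_add[symmetric])
      also have "f p n \<le> (\<Sum>p\<in>X. f p n)" using pk assms(3) f0 by (intro member_le_sum) auto
      finally show ?thesis using C(1) by (simp add: mult_left_mono abs_mult)
    qed
  qed
  then show ?thesis by (subst summable_Suc_iff)
qed

lemma degree_zero_conductor:
  fixes a b :: "nat \<Rightarrow> complex"
  assumes fe: "functional_equation F \<epsilon> Q 0 w \<mu>" and hol: "F holomorphic_on - {1}"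
    and dir: "\<And>s. Re s > 1 \<Longrightarrow> dirichlet_sums a s (F s)"
    and a1: "a 1 = 1"
    and supp: "\<And>n. n > 0 \<Longrightarrow> a n \<noteq> 0 \<Longrightarrow> \<exists>m>0. real (m * n) = Q\<^sup>2"
    and log: "\<And>s. Re s > 1 \<Longrightarrow> \<exists>L. dirichlet_sums b s L \<and> exp L = F s"
    and pp: "\<And>n. \<not> primepow n \<Longrightarrow> b n = 0"
    and \<theta>: "\<theta> < 1/2" "(\<lambda>n. norm (b n)) \<in> O(\<lambda>n. real n powr \<theta>)"
  shows "Q = 1"
proof -
  have Q: "Q > 0" using fe by (simp add: functional_equation_def)
  obtain q where q: "q > 0" "real q = Q\<^sup>2" using supp[of 1] a1 by auto
  have a_dvd: "n dvd q" if "n > 0" "a n \<noteq> 0" for n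
    using supp[OF that] unfolding q(2)[symmetric] of_nat_eq_iff by (metis dvd_triv_right)
  define D where "D = {d. d dvd q}"
  have D: "finite D" "\<And>d. d \<in> D \<Longrightarrow> d > 0" using q(1) by (auto simp: D_def dvd_pos_nat)
  define P where "P = (\<lambda>s. \<Sum>d\<in>D. a d * of_nat d powr (- s))"
  define P' where "P' = (\<lambda>s. \<Sum>d\<in>D. - of_real (ln (real d)) * a d * of_nat d powr (- s))"
  have dP: "(P has_field_derivative P' s) (at s)" for s
    unfolding P_def P'_def
  proof (rule DERIV_sum)
    fix d assume "d \<in> D"
    from DERIV_cmult[OF has_field_derivative_of_nat_powr_minus[OF D(2)[OF this]], of "a d"]
    show "((\<lambda>s. a d * of_nat d powr (- s)) has_field_derivative - of_real (ln (real d)) * a d * of_nat d powr (- s)) (at s)"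
      by (simp only: mult_ac)
  qed
  \<comment> \<open>The point 1 is left out because holomorphy of \<open>F\<close> is only assumed
    off 1; \<open>P\<close> is entire.\<close>
  have F_P: "F s = P s" if "s \<noteq> 1" for s
  proof -
    have "F s = P s" if s: "Re s > 1" for s
    proof -
      have "(\<lambda>n. a (Suc n) * of_nat (Suc n) powr (- s)) sums (\<Sum>n\<in>(\<lambda>d. d - 1) ` D. a (Suc n) * of_nat (Suc n) powr (- s))"
      proof (rule sums_finite)
        fix n assume n: "n \<notin> (\<lambda>d. d - 1) ` D"
        have "a (Suc n) = 0"
        proof (rule ccontr)
          assume "a (Suc n) \<noteq> 0"
          then have "Suc n \<in> D" using a_dvd by (simp add: D_def)
          then have "Suc n - 1 \<in> (\<lambda>d. d - 1) ` D" by (rule imageI)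
          then show False using n by simp
        qed
        then show "a (Suc n) * of_nat (Suc n) powr (- s) = 0" by simp
      qed (use D in simp)
      also have "(\<Sum>n\<in>(\<lambda>d. d - 1) ` D. a (Suc n) * of_nat (Suc n) powr (- s)) = P s"
      proof -
        have "inj_on (\<lambda>d. d - 1) D"
        proof (rule inj_onI)
          fix x y assume "x \<in> D" "y \<in> D" "x - 1 = y - 1"
          then show "x = y" using D(2)[of x] D(2)[of y] by linarith
        qed
        then show ?thesis
          unfolding P_def using D(2) by (subst sum.reindex) (auto intro!: sum.cong simp del: of_nat_Suc)
      qed
      finally show ?thesis using dir[OF s] sums_unique2 unfolding dirichlet_sums_def by blast
    qed
    then show ?thesis
    proof (intro analytic_continuation_open[of "{s. Re s > 1}" "- {1}" F P s])
      show "connected (- {1 :: complex})" by (rule connected_punctured_universe) simp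
      show "{s. Re s > 1} \<noteq> {}" by (auto intro: exI[of _ 2])
      show "P holomorphic_on - {1}" using dP by (meson field_differentiable_at_within field_differentiable_def holomorphic_on_def)
    qed (use hol that in \<open>auto simp: open_halfspace_Re_gt\<close>)
  qed
  have sb: "summable (\<lambda>n. norm (b (Suc n)) * real (Suc n) powr (- 2))"
    by (rule summable_dirichlet_bigo[OF \<theta>(2)]) (use \<theta>(1) in simp)
  \<comment> \<open>If \<open>N\<close> is coprime to \<open>q\<close>, the only contribution to the \<open>N\<close>-th coefficient of \<open>F * (log F)'\<close>
    comes from \<open>a 1 * b N\<close>, while \<open>F'\<close> has no such coefficient.\<close>
  have b_smooth: "b N = 0" if N: "coprime N q" "N > 1" for N
  proof -
    obtain g g' where gg: "\<forall>s. Re s > 2 \<longrightarrow> dirichlet_sums b s (g s) \<and>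
        dirichlet_sums (\<lambda>n. - of_real (ln (real n)) * b n) s (g' s) \<and> (g has_field_derivative g' s) (at s)"
      using dirichlet_series_derivative[OF sb] by blast
    have g: "dirichlet_sums b s (g s)" and g': "dirichlet_sums (\<lambda>n. - of_real (ln (real n)) * b n) s (g' s)"
      and dg: "(g has_field_derivative g' s) (at s)" if "Re s > 2" for s
      using gg that by blast+
    have exp_g: "exp (g s) = P s" if s: "Re s > 2" for s
    proof -
      obtain L where "dirichlet_sums b s L" "exp L = F s" using log[of s] s by auto
      moreover have "s \<noteq> 1" using s by auto
      ultimately show ?thesis using g[OF s] F_P[of s] sums_unique2 unfolding dirichlet_sums_def by metis
    qed
    have P'_eq: "P' s = P s * g' s" if s: "Re s > 2" for s
    proof -
      have "((\<lambda>s. exp (g s)) has_field_derivative P s * g' s) (at s)"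
        using DERIV_chain2[OF DERIV_exp dg[OF s]] exp_g[OF s] by simp
      then have "(P has_field_derivative P s * g' s) (at s)"
        by (rule has_field_derivative_transform_within_open[where S = "{s. Re s > 2}"])
           (use s exp_g in \<open>auto simp: open_halfspace_Re_gt\<close>)
      then show ?thesis using dP DERIV_unique by blast
    qed
    define \<beta> where "\<beta> = (\<lambda>n. - of_real (ln (real n)) * b n)"
    \<comment> \<open>The logarithm in the coefficients of the derivative costs at most one power of
      n, hence the line Re s = 3 when the series of \<open>b\<close> is controlled at 2.\<close>
    have s\<beta>: "summable (\<lambda>n. norm (\<beta> (Suc n)) * real (Suc n) powr (- 3))"
    proof (rule summable_comparison_test'[OF sb])
      fix n :: nat
      have "ln (real (Suc n)) \<le> real (Suc n)" using ln_bound[of "real (Suc n)"] by simp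
      then have "norm (\<beta> (Suc n)) * real (Suc n) powr (- 3) \<le> real (Suc n) * norm (b (Suc n)) * real (Suc n) powr (- 3)"
        unfolding \<beta>_def by (intro mult_right_mono) (auto simp: norm_mult simp del: of_nat_Suc intro!: mult_right_mono)
      also have "\<dots> = norm (b (Suc n)) * (real (Suc n) powr 1 * real (Suc n) powr (- 3))"
        by (simp del: of_nat_Suc)
      also have "\<dots> = norm (b (Suc n)) * real (Suc n) powr (- 2)"
        unfolding powr_add[symmetric] by simp
      finally show "norm (norm (\<beta> (Suc n)) * real (Suc n) powr (- 3)) \<le> norm (b (Suc n)) * real (Suc n) powr (- 2)"
        by (simp add: abs_mult del: of_nat_Suc)
    qed
    have dir_g': "dirichlet_sums \<beta> (Complex 3 t) (g' (Complex 3 t))" for t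
      using g'[of "Complex 3 t"] by (simp add: \<beta>_def)
    have N0: "N > 0" using N by simp
    let ?J = "\<lambda>t. P' (Complex 3 t) * cis (ln (real N) * t)"
    have pw: "of_nat d powr (- Complex 3 t) * cis (ln (real N) * t) = of_real (real d powr (- 3)) * cis (ln (real N / real d) * t)"
      if "d \<in> D" for d t
    proof -
      have "- Complex 3 t = Complex (- 3) (- t)" by (simp add: complex_eq_iff)
      then have "of_nat d powr (- Complex 3 t) = of_real (real d powr (- 3)) * cis (ln (real d) * (- t))"
        using of_nat_powr_Complex[OF D(2)[OF that], of "- 3" "- t"] by simp
      moreover have "cis (ln (real d) * (- t)) * cis (ln (real N) * t) = cis (ln (real N / real d) * t)"
        using D(2)[OF that] N0 by (simp add: cis_mult ln_div algebra_simps)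
      ultimately show ?thesis by (simp only: mult.assoc)
    qed
    \<comment> \<open>The frequencies of P' s * N powr s are ln (N / d) with d a divisor of q. None
      vanishes: N is coprime to q and exceeds 1, so it does not divide q.\<close>
    have "((\<lambda>T. integral {0..T} ?J / of_real T) \<longlongrightarrow> 0) at_top"
    proof -
      have J: "?J = (\<lambda>t. \<Sum>d\<in>D. - of_real (ln (real d)) * a d * of_real (real d powr (- 3)) * cis (ln (real N / real d) * t))"
        unfolding P'_def sum_distrib_right by (intro ext sum.cong refl) (simp only: mult.assoc pw)
      have "((\<lambda>T. integral {0..T} ?J / of_real T) \<longlongrightarrow> (\<Sum>d\<in>D. 0)) at_top"
        unfolding J
      proof (rule mean_value_sum)
        fix d assume d: "d \<in> D"
        show "continuous_on UNIV (\<lambda>t. - of_real (ln (real d)) * a d * of_real (real d powr (- 3)) * cis (ln (real N / real d) * t))"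
          by (intro continuous_intros)
        have "real N / real d \<noteq> 1"
        proof
          assume "real N / real d = 1"
          then have "N = d" using D(2)[OF d] by simp
          then show False using N d by (simp add: D_def coprime_absorb_left)
        qed
        then have l0: "ln (real N / real d) \<noteq> 0" using N0 D(2)[OF d] by simp
        have "((\<lambda>T. integral {0..T} (\<lambda>t. cis (ln (real N / real d) * t)) / of_real T) \<longlongrightarrow> 0) at_top"
        proof (rule Lim_null_comparison)
          let ?K = "2 / \<bar>ln (real N / real d)\<bar>"
          show "((\<lambda>T. ?K / T) \<longlongrightarrow> 0) at_top" by real_asymp
          show "\<forall>\<^sub>F T in at_top. norm (integral {0..T} (\<lambda>t. cis (ln (real N / real d) * t)) / of_real T) \<le> ?K / T"
            using eventually_gt_at_top[of 0]
          proof eventually_elim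
            case (elim T)
            then show ?case using integral_cis_bound[OF l0, of 0 T] by (simp only: norm_divide norm_of_real abs_of_pos less_imp_le divide_right_mono)
          qed
        qed
        from tendsto_mult_right_zero[OF this, of "- of_real (ln (real d)) * a d * of_real (real d powr (- 3))"]
        show "((\<lambda>T. integral {0..T} (\<lambda>t. - of_real (ln (real d)) * a d * of_real (real d powr (- 3)) * cis (ln (real N / real d) * t)) / of_real T) \<longlongrightarrow> 0) at_top"
          by simp
      qed (rule D(1))
      then show ?thesis by simp
    qed
    moreover have "((\<lambda>T. integral {0..T} ?J / of_real T) \<longlongrightarrow> \<beta> N * of_real (real N powr (- 3))) at_top"
    proof -
      let ?h = "\<lambda>d t. a d * of_real (real d powr (- 3)) * (g' (Complex 3 t) * cis (ln (real N / real d) * t))"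
      have J: "?J = (\<lambda>t. \<Sum>d\<in>D. ?h d t)"
      proof (rule ext)
        fix t
        have "?J t = (\<Sum>d\<in>D. a d * of_nat d powr (- Complex 3 t) * (g' (Complex 3 t) * cis (ln (real N) * t)))"
          using P'_eq[of "Complex 3 t"] unfolding P_def by (simp add: sum_distrib_right mult.assoc)
        also have "\<dots> = (\<Sum>d\<in>D. ?h d t)"
        proof (rule sum.cong[OF refl])
          fix d assume d: "d \<in> D"
          have "a d * of_nat d powr (- Complex 3 t) * (g' (Complex 3 t) * cis (ln (real N) * t)) =
              a d * g' (Complex 3 t) * (of_nat d powr (- Complex 3 t) * cis (ln (real N) * t))" by (simp only: mult_ac)
          also have "\<dots> = ?h d t" unfolding pw[OF d] by (simp only: mult_ac)
          finally show "a d * of_nat d powr (- Complex 3 t) * (g' (Complex 3 t) * cis (ln (real N) * t)) = ?h d t" .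
        qed
        finally show "?J t = (\<Sum>d\<in>D. ?h d t)" .
      qed
      \<comment> \<open>In the product form P * g', the divisor d meets the coefficient of g' at N /
        d. This is an integer only if d divides both N and q, that is, if d = 1.\<close>
      have "((\<lambda>T. integral {0..T} ?J / of_real T) \<longlongrightarrow> (\<Sum>d\<in>D. if d = 1 then \<beta> N * of_real (real N powr (- 3)) else 0)) at_top"
        unfolding J
      proof (rule mean_value_sum)
        fix d assume d: "d \<in> D"
        have x: "real N / real d > 0" using N0 D(2)[OF d] by simp
        note mv = dirichlet_mean_value[OF s\<beta> dir_g' x]
        show "continuous_on UNIV (?h d)"
          by (intro continuous_on_mult continuous_on_const mv(1))
        have scale: "((\<lambda>T. integral {0..T} (?h d) / of_real T) \<longlongrightarrow> a d * of_real (real d powr (- 3)) * m) at_top"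
          if "((\<lambda>T. integral {0..T} (\<lambda>t. g' (Complex 3 t) * cis (ln (real N / real d) * t)) / of_real T) \<longlongrightarrow> m) at_top" for m
          using tendsto_mult_left[OF that, of "a d * of_real (real d powr (- 3))"] by simp
        show "((\<lambda>T. integral {0..T} (?h d) / of_real T) \<longlongrightarrow> (if d = 1 then \<beta> N * of_real (real N powr (- 3)) else 0)) at_top"
        proof (cases "d = 1")
          case True
          then show ?thesis using scale[OF mv(2)[OF N0]] a1 by simp
        next
          case False
          have "real n \<noteq> real N / real d" for n
          proof
            assume "real n = real N / real d"
            then have "real (n * d) = real N" using D(2)[OF d] by (simp add: field_simps)
            then have "d dvd N" unfolding of_nat_eq_iff by auto
            moreover have "d dvd q" using d by (simp add: D_def)
            ultimately show False using N(1) False by (metis coprime_def nat_dvd_1_iff_1)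
          qed
          then show ?thesis using scale[OF mv(3)] False by simp
        qed
      qed (rule D(1))
      moreover have "1 \<in> D" by (simp add: D_def)
      ultimately show ?thesis using D(1) by simp
    qed
    ultimately have "\<beta> N * of_real (real N powr (- 3)) = 0"
      by (rule tendsto_unique[OF trivial_limit_at_top_linorder, rotated])
    then show ?thesis using N by (simp add: \<beta>_def)
  qed
  \<comment> \<open>The midpoint between \<theta> and 1/2: to the right of \<theta> for absolute
    convergence, to the left of the critical line so that \<open>g\<close> is holomorphic around
    it.\<close>
  define \<delta> where "\<delta> = (\<theta> + 1/2) / 2"
  have \<delta>: "\<theta> < \<delta>" "\<delta> < 1/2" using \<theta>(1) by (auto simp: \<delta>_def)
  have sd: "summable (\<lambda>n. norm (b (Suc n)) * real (Suc n) powr (- \<delta>))"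
  proof (rule summable_dirichlet_smooth_primepow[OF \<theta>(2) \<delta>(1), of "prime_factors q"])
    fix n assume bn: "b n \<noteq> 0"
    then have "primepow n" using pp by blast
    then obtain p k where pk: "prime p" "k > 0" "n = p ^ k" unfolding primepow_def by auto
    have "p dvd q"
    proof (rule ccontr)
      assume "\<not> p dvd q"
      then have "coprime n q" using pk by (simp add: prime_imp_coprime)
      moreover have "n > 1" using pk prime_gt_1_nat one_less_power by blast
      ultimately show False using b_smooth bn by blast
    qed
    then have "p \<in> prime_factors q" using pk q(1) by (simp add: prime_factors_dvd)
    then show "\<exists>p\<in>prime_factors q. \<exists>k. n = p ^ k" using pk by blast
  qed auto
  obtain g g' where gg: "\<forall>s. Re s > \<delta> \<longrightarrow> dirichlet_sums b s (g s) \<and>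
      dirichlet_sums (\<lambda>n. - of_real (ln (real n)) * b n) s (g' s) \<and> (g has_field_derivative g' s) (at s)"
    using dirichlet_series_derivative[OF sd] by blast
  have g: "dirichlet_sums b s (g s)" and dg: "(g has_field_derivative g' s) (at s)" if "Re s > \<delta>" for s
    using gg that by blast+
  have exp_g: "exp (g s) = P s" if s: "Re s > \<delta>" for s
  proof (rule analytic_continuation_open[of "{s. Re s > 1}" "{s. Re s > \<delta>}" "\<lambda>s. exp (g s)" P s])
    show "connected {s. Re s > \<delta>}" by (intro convex_connected convex_halfspace_Re_gt)
    show "{s. Re s > 1} \<noteq> {}" by (auto intro: exI[of _ 2])
    show "P holomorphic_on {s. Re s > \<delta>}" "(\<lambda>s. exp (g s)) holomorphic_on {s. Re s > \<delta>}"
      using dP DERIV_chain2[OF DERIV_exp dg]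
      by (auto simp: holomorphic_on_open open_halfspace_Re_gt)
    fix z assume "z \<in> {s. Re s > 1}"
    then have z: "Re z > 1" by simp
    then obtain L where "dirichlet_sums b z L" "exp L = F z" using log by blast
    moreover have "z \<noteq> 1" using z by auto
    ultimately show "exp (g z) = P z"
      using g[of z] z \<delta>(2) F_P[of z] sums_unique2[of _ "g z" L] unfolding dirichlet_sums_def by auto
  qed (use s \<delta> in \<open>auto simp: open_halfspace_Re_gt\<close>)
  define u where "u = (\<lambda>t. g (Complex (1/2) t))"
  define B where "B = (\<Sum>n. norm (b (Suc n)) * real (Suc n) powr (- (1/2)))"
  have u_le: "norm (u t) \<le> B" for t
  proof -
    have "summable (\<lambda>n. norm (b (Suc n)) * real (Suc n) powr (- (1/2)))"
    proof (rule summable_comparison_test'[OF sd])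
      fix n
      have "real (Suc n) powr (- (1/2)) \<le> real (Suc n) powr (- \<delta>)" using \<delta> by (intro powr_mono) auto
      then show "norm (norm (b (Suc n)) * real (Suc n) powr (- (1/2))) \<le> norm (b (Suc n)) * real (Suc n) powr (- \<delta>)"
        by (simp add: abs_mult mult_left_mono del: of_nat_Suc)
    qed
    moreover have "(\<lambda>n. b (Suc n) * of_real (real (Suc n) powr (- (1/2))) * cis (- ln (real (Suc n)) * t)) sums u t"
      using g[of "Complex (1/2) t"] \<delta> unfolding dirichlet_sums_Complex u_def by simp
    ultimately show ?thesis
      unfolding B_def sums_unique[OF \<open>_ sums u t\<close>] by (intro norm_suminf_le) (auto simp: norm_mult)
  qed
  \<comment> \<open>Twice the argument of Q powr s * F s on the critical line. Doubling it removes
    the sign of the real number \<epsilon> * Q powr s * F s.\<close>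
  define v where "v = (\<lambda>t. 2 * Im (u t) + 2 * ln Q * t)"
  have cis_v: "cis (v t) = (cnj \<epsilon>)\<^sup>2" if t: "t > 0" for t
  proof -
    have ne: "Complex (1/2) t \<noteq> 1" by (simp add: complex_eq_iff)
    have "exp (u t) = (cnj \<epsilon>)\<^sup>2 * cis (- 2 * ln Q * t) * cnj (exp (u t))"
      \<comment> \<open>For A = -1/2 both sides live on the critical line, the power of Q is 1, and
        the empty Gamma quotient is 1.\<close>
      using functional_equation_line[OF fe hol t, of "- (1/2)"] F_P[OF ne] exp_g[of "Complex (1/2) t"] \<delta> Q
      by (simp add: gamma_quotient_def u_def)
    then have "exp (u t) / cnj (exp (u t)) = (cnj \<epsilon>)\<^sup>2 * cis (- 2 * ln Q * t)"
      by (simp add: field_simps)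
    moreover have "exp (u t) / cnj (exp (u t)) = cis (2 * Im (u t))"
    proof -
      have "exp (u t) / cnj (exp (u t)) = exp (u t - cnj (u t))" by (simp add: exp_diff exp_cnj)
      also have "u t - cnj (u t) = \<i> * of_real (2 * Im (u t))" by (simp add: complex_eq_iff)
      finally show ?thesis by (simp only: cis_conv_exp)
    qed
    ultimately have "cis (2 * Im (u t)) = (cnj \<epsilon>)\<^sup>2 * cis (- 2 * ln Q * t)" by simp
    then have "cis (2 * Im (u t)) * cis (2 * ln Q * t) = (cnj \<epsilon>)\<^sup>2 * (cis (- 2 * ln Q * t) * cis (2 * ln Q * t))"
      by (simp only: mult.assoc)
    then show ?thesis by (simp add: cis_mult v_def)
  qed
  have "continuous_on {0<..} v"
  proof -
    have "continuous_on {s. Re s > \<delta>} g"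
      by (intro continuous_at_imp_continuous_on ballI DERIV_isCont[OF dg]) simp
    moreover have "continuous_on {0<..} (\<lambda>t. Complex (1/2) t)" unfolding Complex_eq by (intro continuous_intros)
    ultimately have "continuous_on {0<..} u"
      unfolding u_def by (rule continuous_on_compose2) (use \<delta> in auto)
    then show ?thesis unfolding v_def by (intro continuous_intros)
  qed
  \<comment> \<open>All values of the continuous function \<open>v\<close> differ by multiples of 2
    * pi, and the half-line is connected.\<close>
  then have "v constant_on {0<..}"
  proof (rule continuous_discrete_range_constant[rotated])
    fix x :: real assume x: "x \<in> {0<..}"
    show "\<exists>e>0. \<forall>y. y \<in> {0<..} \<and> v y \<noteq> v x \<longrightarrow> e \<le> norm (v y - v x)"
    proof (intro exI conjI allI impI)
      fix y assume y: "y \<in> {0<..} \<and> v y \<noteq> v x"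
      have "cis (v y) = cis (v x)" using cis_v x y by simp
      then have "sin (v y) = sin (v x) \<and> cos (v y) = cos (v x)" by (simp add: complex_eq_iff)
      then obtain n :: int where n: "v y = v x + 2 * pi * n" unfolding sin_cos_eq_iff by blast
      then have "\<bar>real_of_int n\<bar> \<ge> 1" using y by (cases "n = 0") auto
      then show "2 * pi \<le> norm (v y - v x)" unfolding n by (simp add: abs_mult)
    qed (use pi_gt_zero in simp)
  qed (rule connected_Ioi)
  then have v_const: "v t = v 1" if "t > 0" for t
    using that unfolding constant_on_def by (metis greaterThan_iff zero_less_one)
  have "ln Q = 0"
  proof (rule ccontr)
    assume ne: "ln Q \<noteq> 0"
    have B0: "B \<ge> 0" using u_le[of 1] norm_ge_zero order_trans by blast
    \<comment> \<open>Chosen so that \<bar>ln Q\<bar> * (t - 1) = 2 * B + 1, more than two values of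
      Im u can differ.\<close>
    define t where "t = 1 + (2 * B + 1) / \<bar>ln Q\<bar>"
    have "t > 0" using B0 by (simp add: t_def add_pos_nonneg)
    from v_const[OF this] have "ln Q * (t - 1) = Im (u 1) - Im (u t)"
      by (simp add: v_def algebra_simps)
    then have "\<bar>ln Q\<bar> * \<bar>t - 1\<bar> = \<bar>Im (u 1) - Im (u t)\<bar>" by (metis abs_mult)
    also have "\<dots> \<le> B + B"
      using abs_Im_le_cmod[of "u 1"] abs_Im_le_cmod[of "u t"] u_le[of 1] u_le[of t] by linarith
    finally show False using ne B0 by (simp add: t_def)
  qed
  then show ?thesis using Q by simp
qed

theorem theorem3p1:
  fixes F :: "complex \<Rightarrow> complex" and d :: real
  assumes "F \<in> selberg_class"
    and "has_selberg_degree F d"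
  shows "F = (\<lambda>_. 1) \<or> d \<ge> 1"
proof (cases "d \<ge> 1")
  case False
  \<comment> \<open>The Gamma factor used throughout is the one that computes \<open>d\<close>, so
    independence of the degree from the factor is never invoked.\<close>
  obtain \<epsilon> Q k w \<mu> where fe: "functional_equation F \<epsilon> Q k w \<mu>" and d: "d = 2 * (\<Sum>i<k. w i)"
    using assms(2) unfolding has_selberg_degree_def by blast
  have nice: "F nicely_meromorphic_on UNIV" using assms(1) by (simp add: selberg_class_def)
  obtain a m G b \<theta> where dir: "\<And>s. Re s > 1 \<Longrightarrow> dirichlet_sums a s (F s)"
    and G: "G holomorphic_on UNIV" "finite_order G" "\<And>s. s \<noteq> 1 \<Longrightarrow> G s = (s - 1) ^ m * F s"
    and ram: "\<And>\<epsilon>::real. \<epsilon> > 0 \<Longrightarrow> (\<lambda>n. norm (a n)) \<in> O(\<lambda>n. real n powr \<epsilon>)"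
    and a1: "a 1 = 1"
    and log: "\<And>s. Re s > 1 \<Longrightarrow> \<exists>L. dirichlet_sums b s L \<and> exp L = F s"
    and pp: "\<And>n. \<not> primepow n \<Longrightarrow> b n = 0"
    and \<theta>: "\<theta> < 1/2" "(\<lambda>n. norm (b n)) \<in> O(\<lambda>n. real n powr \<theta>)"
    using assms(1) unfolding selberg_class_def by blast
  have F_eq: "F s = G s / (s - 1) ^ m" if "s \<noteq> 1" for s using G(3)[OF that] that by simp
  have hol: "F holomorphic_on - {1}"
  proof -
    have "(\<lambda>s. G s / (s - 1) ^ m) holomorphic_on - {1}"
      by (intro holomorphic_intros holomorphic_on_subset[OF G(1)]) auto
    then show ?thesis by (rule holomorphic_transform) (simp add: F_eq)
  qed
  obtain C :: real and p :: nat where C: "\<And>s. norm s \<ge> 1 \<Longrightarrow> norm (G s) \<le> C * exp (norm s ^ p)"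
    using finite_order_imp_bound[OF G(1,2)] by blast
  \<comment> \<open>For Im s \<ge> 1 the factor (s - 1) ^ m has modulus at least 1, so the bound for
    \<open>G\<close> passes to \<open>F\<close>.\<close>
  have growth: "norm (F s) \<le> C * exp (norm s ^ p)" if s: "Im s \<ge> 1" for s
  proof -
    have "norm s \<ge> 1" "norm (s - 1) \<ge> 1"
      using s abs_Im_le_cmod[of s] abs_Im_le_cmod[of "s - 1"] by simp_all
    then have "norm (F s) * 1 \<le> norm (F s) * norm (s - 1) ^ m"
      by (intro mult_left_mono one_le_power) auto
    also have "\<dots> = norm (G s)"
    proof -
      have "s \<noteq> 1" using s by auto
      then show ?thesis using G(3)[of s] by (simp add: norm_mult norm_power mult.commute)
    qed
    finally show ?thesis using C[OF \<open>norm s \<ge> 1\<close>] by simp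
  qed
  have k0: "k = 0" and supp: "\<And>n. n > 0 \<Longrightarrow> a n \<noteq> 0 \<Longrightarrow> \<exists>m>0. real (m * n) = Q\<^sup>2"
    using degree_less_one_coefficients[OF fe _ hol growth dir ram a1] False d by auto
  have Q: "Q = 1"
    by (rule degree_zero_conductor[OF fe[unfolded k0] hol dir a1 supp log pp \<theta>])
  have F1: "F s = 1" if "Re s > 1" for s
  proof -
    \<comment> \<open>With Q = 1 the support condition reads m * n = 1, so only the coefficient at 1
      survives.\<close>
    have "a (Suc n) = 0" if "n \<noteq> 0" for n
      using supp[of "Suc n"] that unfolding Q by (auto simp del: of_nat_mult of_nat_Suc mult_Suc_right)
    then have "(\<lambda>n. a (Suc n) * of_nat (Suc n) powr (- s)) sums (\<Sum>n\<in>{0}. a (Suc n) * of_nat (Suc n) powr (- s))"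
      by (intro sums_finite) auto
    then show ?thesis using dir[OF that] a1 sums_unique2 unfolding dirichlet_sums_def by fastforce
  qed
  have F1': "F s = 1" if "s \<noteq> 1" for s
  proof (rule analytic_continuation_open[of "{s. Re s > 1}" "- {1}" F "\<lambda>_. 1" s])
    show "connected (- {1 :: complex})" by (rule connected_punctured_universe) simp
    show "{s. Re s > 1} \<noteq> {}" by (auto intro: exI[of _ 2])
  qed (use hol that F1 in \<open>auto simp: open_halfspace_Re_gt\<close>)
  have lim: "F \<midarrow>1\<rightarrow> 1"
    by (rule tendsto_eventually) (auto simp: eventually_at_filter F1')
  have "F 1 = 1"
  proof -
    \<comment> \<open>The finite limit excludes a pole, and then nice meromorphy identifies F 1 with
      the limit.\<close>
    have "\<not> is_pole F 1"
      using lim not_tendsto_and_filterlim_at_infinity[OF at_neq_bot] unfolding is_pole_def by blast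
    then have "F \<midarrow>1\<rightarrow> F 1" using nice unfolding nicely_meromorphic_on_def by auto
    then show ?thesis using lim LIM_unique by blast
  qed
  with F1' have "F = (\<lambda>_. 1)" by (metis (full_types) ext)
  then show ?thesis by blast
qed simp

end
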